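(* Consider the elliptic inverse problem in the large data limit with $d=1$, $D=[0,1]$: observations $y_i=p(x_i;a)+\xi_i$, $i=1,\dots,n$, with $\xi_i$ i.i.d. $\mathcal{N}(0,\sigma^2)$. Suppose that the sequence $\{x_i\}_{i\in\mathbb{N}}\subset[0,1]$ is such that there exists $K>0$ so that for any $b<c$ in $[0,1]$ there is an $N(b,c)$ with $$F_n(c)-F_n(b)\ge K(c-b)\qquad\forall n>N(b,c),$$ where $F_n$ denotes the empirical distribution function of $\{x_i\}_{i=1}^n$. Suppose further that $\|a\|_{C^\gamma}\le L$ $\mu_0$-a.s. for some $\gamma>1$ and constant $L$, and $a\ge a_{\min}$ $\mu_0$-a.s. for a constant $a_{\min}>0$. If $a^\dagger\in\operatorname{supp}_{C^\gamma}\mu_0$, then the elliptic inverse problem is posterior consistent for $a^\dagger$ in the large data limit with respect to the $C^{\tilde\gamma}$-norm for any $\tilde\gamma<\gamma$.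
   Context: Forward model: $f$ is smooth on $\bar D$ with $f>f_{\min}>0$. For a coefficient $a\in C^1(D)\cap C(\bar D)$ bounded below by a positive constant, $p(\cdot;a)$ denotes the solution of $$-\nabla\cdot(a\nabla p)=f\ \text{ in }D,\qquad p=0\ \text{ on }\partial D.$$ Posterior given $y_{1:n}$: $$\frac{d\mu^{y_{1:n}}}{d\mu_0}(a)\propto\exp\Big(-\sum_{i=1}^n\frac{(p(x_i;a)-y_i)^2}{2\sigma^2}\Big).$$ Posterior consistency for $a^\dagger$ with respect to a norm: for data $y_i=p(x_i;a^\dagger)+\xi_i$ and every fixed radius $\epsilon>0$, there exists a sequence $l_n\to1$ such that $\mathbb{P}_\xi\big(\mu^{y_{1:n}}(B_\epsilon(a^\dagger))\ge l_n\big)\to1$ as $n\to\infty$, balls taken in the given norm. $\operatorname{supp}_d(\mu)=\{x:\mu(B^d_\epsilon(x))>0\ \forall\epsilon>0\}$; $\operatorname{supp}_{C^\gamma}$ uses the metric of the Hölder space $C^\gamma$. *)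

theory Defs
  imports "HOL-Probability.Probability"
begin

text \<open>
  Functions on the closed interval \<open>[0,1]\<close> are represented by \<open>real \<Rightarrow> real\<close>; every notion
  below depends only on their values on \<open>{0..1}\<close>.  Derivatives are taken within \<open>{0..1}\<close>,
  hence are one-sided at the end points.
\<close>

fun D01 :: "nat \<Rightarrow> (real \<Rightarrow> real) \<Rightarrow> real \<Rightarrow> real" where
  "D01 0 g = g"
| "D01 (Suc k) g = (\<lambda>x. vector_derivative (D01 k g) (at x within {0..1}))"

definition Ck01 :: "nat \<Rightarrow> (real \<Rightarrow> real) \<Rightarrow> bool" where
  "Ck01 k g \<longleftrightarrow>
     (\<forall>j<k. \<forall>x\<in>{0..1}. D01 j g differentiable (at x within {0..1})) \<and>
     continuous_on {0..1} (D01 k g)"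

definition smooth01 :: "(real \<Rightarrow> real) \<Rightarrow> bool" where
  "smooth01 g \<longleftrightarrow> (\<forall>k. Ck01 k g)"

text \<open>
  The norm of \<open>C\<^sup>\<gamma>\<close>, \<open>\<gamma> \<ge> 0\<close>, extended by \<open>\<infinity>\<close> to functions outside of \<open>C\<^sup>\<gamma>\<close>, so that
  \<open>holder_norm \<gamma> g < \<infinity>\<close> says \<open>g \<in> C\<^sup>\<gamma>\<close>.  For \<open>\<gamma> = k + \<alpha>\<close> with \<open>0 < \<alpha> < 1\<close> the last derivative
  is \<open>\<alpha>\<close>-Hoelder continuous; for integer \<open>\<gamma> = k\<close> this is the usual space of \<open>k\<close> times
  continuously differentiable functions.
\<close>

definition holder_norm :: "real \<Rightarrow> (real \<Rightarrow> real) \<Rightarrow> ennreal" where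
  "holder_norm \<gamma> g =
     (let k = nat \<lfloor>\<gamma>\<rfloor>; \<alpha> = frac \<gamma> in
      if Ck01 k g then
        (\<Sum>j\<le>k. SUP x\<in>{0..1}. ennreal \<bar>D01 j g x\<bar>) +
        (if \<alpha> = 0 then 0
         else SUP (s, t)\<in>{(s, t). s \<in> {0..1} \<and> t \<in> {0..1} \<and> s \<noteq> t}.
                ennreal (\<bar>D01 k g s - D01 k g t\<bar> / \<bar>s - t\<bar> powr \<alpha>))
      else \<infinity>)"

text \<open>The ball in \<open>C\<^sup>\<gamma>\<close> with centre \<open>a\<close>, as an event of the measure \<open>\<mu>\<close>.\<close>

definition holder_ball ::
    "(real \<Rightarrow> real) measure \<Rightarrow> real \<Rightarrow> (real \<Rightarrow> real) \<Rightarrow> real \<Rightarrow> (real \<Rightarrow> real) set" where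
  "holder_ball \<mu> \<gamma> a \<epsilon> =
     {b \<in> space \<mu>. holder_norm \<gamma> (\<lambda>t. b t - a t) < ennreal \<epsilon>}"

definition holder_supp :: "real \<Rightarrow> (real \<Rightarrow> real) measure \<Rightarrow> (real \<Rightarrow> real) set" where
  "holder_supp \<gamma> \<mu> =
     {a. holder_norm \<gamma> a < \<infinity> \<and> (\<forall>\<epsilon>>0. emeasure \<mu> (holder_ball \<mu> \<gamma> a \<epsilon>) > 0)}"

text \<open>
  A probability measure on continuous functions on \<open>[0,1]\<close>.  The \<open>\<sigma>\<close>-algebra is only required
  to make the point evaluations measurable.  This holds for the Borel \<open>\<sigma>\<close>-algebra of
  \<open>C([0,1])\<close>, which is generated by the evaluations, and for that of any space \<open>C\<^sup>\<gamma>\<close>.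
\<close>

definition prior_measure :: "(real \<Rightarrow> real) measure \<Rightarrow> bool" where
  "prior_measure \<mu> \<longleftrightarrow>
     prob_space \<mu> \<and> space \<mu> \<subseteq> {a. continuous_on {0..1} a} \<and>
     (\<forall>x\<in>{0..1}. (\<lambda>a. a x) \<in> borel_measurable \<mu>)"

definition solves_elliptic :: "(real \<Rightarrow> real) \<Rightarrow> (real \<Rightarrow> real) \<Rightarrow> (real \<Rightarrow> real) \<Rightarrow> bool" where
  "solves_elliptic f a p \<longleftrightarrow>
     continuous_on {0..1} p \<and> p 0 = 0 \<and> p 1 = 0 \<and>
     (\<forall>x\<in>{0<..<1}. p differentiable (at x) \<and>
        ((\<lambda>t. a t * deriv p t) has_real_derivative - f x) (at x))"

text \<open>
  \<open>forward f a x\<close> is \<open>p(x; a)\<close>.  Restricting to \<open>extensional {0..1}\<close> fixes the irrelevant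
  values outside of \<open>[0,1]\<close>, which makes the solution unique as a function on \<open>real\<close>.
  The value is unspecified for coefficients without a unique solution.
\<close>

definition forward :: "(real \<Rightarrow> real) \<Rightarrow> (real \<Rightarrow> real) \<Rightarrow> real \<Rightarrow> real" where
  "forward f a = (THE p. p \<in> extensional {0..1} \<and> solves_elliptic f a p)"

definition likelihood ::
    "(real \<Rightarrow> real) \<Rightarrow> real \<Rightarrow> (nat \<Rightarrow> real) \<Rightarrow> (nat \<Rightarrow> real) \<Rightarrow> nat \<Rightarrow> (real \<Rightarrow> real) \<Rightarrow> real" where
  "likelihood f \<sigma> x y n a =
     exp (- (\<Sum>i=1..n. (forward f a (x i) - y i)\<^sup>2 / (2 * \<sigma>\<^sup>2)))"

definition posterior ::
    "(real \<Rightarrow> real) \<Rightarrow> real \<Rightarrow> (real \<Rightarrow> real) measure \<Rightarrow> (nat \<Rightarrow> real) \<Rightarrow> (nat \<Rightarrow> real) \<Rightarrow> nat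
      \<Rightarrow> (real \<Rightarrow> real) measure" where
  "posterior f \<sigma> \<mu>0 x y n =
     density \<mu>0 (\<lambda>a. ennreal (likelihood f \<sigma> x y n a) /
                      (\<integral>\<^sup>+b. ennreal (likelihood f \<sigma> x y n b) \<partial>\<mu>0))"

definition empirical_cdf :: "(nat \<Rightarrow> real) \<Rightarrow> nat \<Rightarrow> real \<Rightarrow> real" where
  "empirical_cdf x n t = real (card {i\<in>{1..n}. x i \<le> t}) / real n"

definition iid_gaussian :: "'w measure \<Rightarrow> real \<Rightarrow> (nat \<Rightarrow> 'w \<Rightarrow> real) \<Rightarrow> bool" where
  "iid_gaussian P \<sigma> \<xi> \<longleftrightarrow>
     prob_space.indep_vars P (\<lambda>_. borel) \<xi> {1..} \<and>
     (\<forall>i\<ge>1. distributed P lborel (\<xi> i) (normal_density 0 \<sigma>))"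

definition posterior_consistent ::
    "'w measure \<Rightarrow> (nat \<Rightarrow> 'w \<Rightarrow> real) \<Rightarrow> (real \<Rightarrow> real) \<Rightarrow> real \<Rightarrow> (real \<Rightarrow> real) measure
      \<Rightarrow> (nat \<Rightarrow> real) \<Rightarrow> real \<Rightarrow> (real \<Rightarrow> real) \<Rightarrow> bool" where
  "posterior_consistent P \<xi> f \<sigma> \<mu>0 x \<gamma> a\<^sub>0 \<longleftrightarrow>
     (\<forall>\<epsilon>>0. \<exists>l :: nat \<Rightarrow> real. l \<longlonglongrightarrow> 1 \<and>
        (\<lambda>n. measure P {\<omega> \<in> space P.
            measure (posterior f \<sigma> \<mu>0 x (\<lambda>i. forward f a\<^sub>0 (x i) + \<xi> i \<omega>) n)
              (holder_ball \<mu>0 \<gamma> a\<^sub>0 \<epsilon>) \<ge> l n}) \<longlonglongrightarrow> 1)"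

end

theory Submission
  imports Defs
begin

text \<open>
  Write \<open>p, q\<close> for the solutions with coefficients \<open>a\<close> and \<open>a_dagger\<close>.  By Rolle's theorem
  \<open>a p' = F z - F\<close> for a primitive \<open>F\<close> of \<open>f\<close> and some \<open>z\<close>, so \<open>p\<close> is uniformly Lipschitz and
  depends continuously on \<open>a\<close>.  Conversely, if \<open>p - q\<close> is uniformly small, then so is \<open>p' - q'\<close> by
  Landau's inequality, then \<open>a - a_dagger\<close> because \<open>q'\<close> vanishes only at one point and does so linearly,
  and finally the \<open>C\<^sup>\<gamma>\<^sup>'\<close> norm of \<open>a - a_dagger\<close> by interpolation with the bound in \<open>C\<^sup>\<gamma>\<close>.

  Hence outside of the ball \<open>\<bar>p - q\<bar>\<close> exceeds a fixed constant on an interval of fixed length, which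
  contains a fixed proportion of the design points, and \<open>\<Sum>i\<le>n. (p (x i) - q (x i))\<^sup>2 \<ge> c n\<close>.  In a small ball
  around \<open>a_dagger\<close>, which has positive prior mass, the same sum is at most \<open>c n / 4\<close>.  The noise
  contributes \<open>o(n)\<close> to the log likelihood uniformly in \<open>a\<close>, by a law of large numbers that is uniform over
  bounded Lipschitz functions, so the posterior odds of the complement of the ball decay exponentially.

  The \<open>\<sigma>\<close>-algebra of the prior is neither assumed complete nor to contain the balls.  The ball in
  \<open>C\<^sup>\<gamma>\<^sup>'\<close> is therefore shown to be measurable on all continuous functions, and the forward map is replaced by
  a measurable version to which it is equal almost everywhere.
\<close>

section \<open>Differentiability on the unit interval\<close>

lemma vector_derivative_01_eq:
  assumes "(g has_real_derivative d) (at x within {0..1})" "x \<in> {0..1}"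
  shows "vector_derivative g (at x within {0..1}) = d"
  using vector_derivative_within_closed_interval[of 0 1 x g d] assms
  by (simp add: has_real_derivative_iff_has_vector_derivative)

lemma Ck01_has_derivative:
  assumes "Ck01 k g" "j < k" "x \<in> {0..1}"
  shows "(D01 j g has_real_derivative D01 (Suc j) g x) (at x within {0..1})"
  using assms vector_derivative_works[of "D01 j g" "at x within {0..1}"]
  by (auto simp: Ck01_def has_real_derivative_iff_has_vector_derivative)

lemma Ck01_continuous_on:
  assumes "Ck01 k g" "j \<le> k"
  shows "continuous_on {0..1} (D01 j g)"
proof (cases "j = k")
  case False
  then show ?thesis
    using Ck01_has_derivative[OF assms(1)] assms(2) DERIV_continuous_on[of "{0..1}"]
    by (metis le_neq_implies_less)
qed (use assms in \<open>simp add: Ck01_def\<close>)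

lemma Ck01_mono: "Ck01 k g \<Longrightarrow> j \<le> k \<Longrightarrow> Ck01 j g"
  using Ck01_continuous_on by (auto simp: Ck01_def)

text \<open>Splits off the condition on the last derivative. This is the form in which
  \<open>C1_iff_quot_equicont\<close> applies in the induction of \<open>sets_Ck01\<close>.\<close>

lemma Ck01_Suc:
  "Ck01 (Suc k) g \<longleftrightarrow> Ck01 k g \<and>
     (\<forall>x\<in>{0..1}. D01 k g differentiable (at x within {0..1})) \<and>
     continuous_on {0..1} (\<lambda>x. vector_derivative (D01 k g) (at x within {0..1}))"
  using Ck01_mono[of "Suc k" g k] by (auto simp: Ck01_def less_Suc_eq)

lemma D01_diff:
  assumes "Ck01 k g" "Ck01 k h" "j \<le> k" "x \<in> {0..1}"
  shows "D01 j (\<lambda>t. g t - h t) x = D01 j g x - D01 j h x"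
  using assms(3,4)
proof (induction j arbitrary: x)
  case (Suc j)
  have "((\<lambda>t. D01 j g t - D01 j h t) has_real_derivative D01 (Suc j) g x - D01 (Suc j) h x)
          (at x within {0..1})"
    using Suc.prems assms by (intro DERIV_diff Ck01_has_derivative) auto
  \<comment> \<open>The induction hypothesis identifies the two functions on \<open>{0..1}\<close>
    only, which is enough for a derivative within \<open>{0..1}\<close>.\<close>
  then have "(D01 j (\<lambda>t. g t - h t) has_real_derivative D01 (Suc j) g x - D01 (Suc j) h x)
          (at x within {0..1})"
    unfolding has_field_derivative_def
    by (rule has_derivative_transform[rotated 2]) (use Suc in auto)
  from vector_derivative_01_eq[OF this] Suc.prems show ?case by simp
qed simp

lemma Ck01_diff:
  assumes "Ck01 k g" "Ck01 k h"
  shows "Ck01 k (\<lambda>t. g t - h t)"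
  unfolding Ck01_def
proof (intro conjI allI impI ballI)
  fix j x assume j: "j < k" and x: "x \<in> {0..1::real}"
  have "((\<lambda>t. D01 j g t - D01 j h t) has_real_derivative D01 (Suc j) g x - D01 (Suc j) h x)
          (at x within {0..1})"
    using j x assms by (intro DERIV_diff Ck01_has_derivative) auto
  then have "(D01 j (\<lambda>t. g t - h t) has_real_derivative D01 (Suc j) g x - D01 (Suc j) h x)
          (at x within {0..1})"
    unfolding has_field_derivative_def
    by (rule has_derivative_transform[rotated 2]) (use D01_diff[OF assms] j x in auto)
  then show "D01 j (\<lambda>t. g t - h t) differentiable at x within {0..1}"
    using real_differentiable_def by blast
next
  have "continuous_on {0..1} (\<lambda>t. D01 k g t - D01 k h t)"
    using assms by (intro continuous_intros Ck01_continuous_on) auto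
  then show "continuous_on {0..1} (D01 k (\<lambda>t. g t - h t))"
    by (rule continuous_on_eq) (use D01_diff[OF assms] in auto)
qed

text \<open>Rounds down to a multiple of \<open>1 / (n + 1)\<close>. For fixed \<open>n\<close> it
  takes only countably many values, so that it composes measurably with point evaluations, and the
  clamp keeps it in \<open>{0..1}\<close> for every real \<open>t\<close>.\<close>

definition grid_approx :: "nat \<Rightarrow> real \<Rightarrow> real" where
  "grid_approx n t = max 0 (min 1 (of_int \<lfloor>real (Suc n) * t\<rfloor> / real (Suc n)))"

definition rat01 :: "real set" where
  "rat01 = \<rat> \<inter> {0..1}"

lemma countable_rat01: "countable rat01"
  unfolding rat01_def by (simp add: countable_rat)

lemma rat01_subset: "rat01 \<subseteq> {0..1}"
  by (auto simp: rat01_def)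

lemma grid_approx_in_rat01: "grid_approx n t \<in> rat01"
  by (auto simp: grid_approx_def rat01_def max_def min_def)

lemma grid_approx_tendsto:
  assumes "t \<in> {0..1}"
  shows "(\<lambda>n. grid_approx n t) \<longlonglongrightarrow> t"
proof -
  have "(\<lambda>n. of_int \<lfloor>real (Suc n) * t\<rfloor> / real (Suc n)) \<longlonglongrightarrow> t"
  proof (rule tendsto_sandwich)
    show "\<forall>\<^sub>F n in sequentially. t - 1 / real (Suc n) \<le> of_int \<lfloor>real (Suc n) * t\<rfloor> / real (Suc n)"
    proof (intro always_eventually allI)
      fix n
      have "real (Suc n) * t - 1 \<le> of_int \<lfloor>real (Suc n) * t\<rfloor>" by linarith
      then have "(real (Suc n) * t - 1) / real (Suc n) \<le> of_int \<lfloor>real (Suc n) * t\<rfloor> / real (Suc n)"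
        by (rule divide_right_mono) simp
      then show "t - 1 / real (Suc n) \<le> of_int \<lfloor>real (Suc n) * t\<rfloor> / real (Suc n)"
        by (simp add: diff_divide_distrib)
    qed
    show "\<forall>\<^sub>F n in sequentially. of_int \<lfloor>real (Suc n) * t\<rfloor> / real (Suc n) \<le> t"
      by (intro always_eventually allI) (simp add: divide_le_eq mult.commute)
    show "(\<lambda>n. t - 1 / real (Suc n)) \<longlonglongrightarrow> t"
      using tendsto_diff[OF tendsto_const LIMSEQ_Suc[OF lim_1_over_n], of t] by simp
  qed simp
  then have "(\<lambda>n. grid_approx n t) \<longlonglongrightarrow> max 0 (min 1 t)"
    unfolding grid_approx_def by (intro tendsto_intros)
  moreover have "max 0 (min 1 t) = t" using assms by auto
  ultimately show ?thesis by simp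
qed

lemma continuous_grid_approx:
  fixes v :: "real \<Rightarrow> real"
  assumes "continuous_on {0..1} v" "t \<in> {0..1}"
  shows "(\<lambda>n. v (grid_approx n t)) \<longlonglongrightarrow> v t"
  using continuous_on_tendsto_compose[OF assms(1) grid_approx_tendsto[OF assms(2)] assms(2)]
    grid_approx_in_rat01 rat01_subset by (meson always_eventually subsetD)

section \<open>Continuous differentiability as a countable condition\<close>

definition diff_quot :: "(real \<Rightarrow> real) \<Rightarrow> real \<Rightarrow> real \<Rightarrow> real" where
  "diff_quot v s t = (v t - v s) / (t - s)"

text \<open>Equicontinuity of the difference quotients, tested on rational points only so that it is a
  measurable condition on \<open>v\<close>.\<close>

definition quot_equicont :: "(real \<Rightarrow> real) \<Rightarrow> real set \<Rightarrow> bool" where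
  "quot_equicont v Q \<longleftrightarrow> (\<forall>m::nat. \<exists>r::nat. \<forall>s\<in>Q. \<forall>t\<in>Q. \<forall>s'\<in>Q. \<forall>t'\<in>Q.
     s \<noteq> t \<and> s' \<noteq> t' \<and> \<bar>s - s'\<bar> < 1 / Suc r \<and> \<bar>s - t\<bar> < 1 / Suc r \<and> \<bar>s' - t'\<bar> < 1 / Suc r \<longrightarrow>
     \<bar>diff_quot v s t - diff_quot v s' t'\<bar> \<le> 1 / Suc m)"

text \<open>The premises on the points are strict inequalities and hence hold eventually for their
  grid approximants. The conclusion is a weak inequality between continuous expressions and survives
  the limit.\<close>

lemma quot_equicont_extend:
  assumes v: "continuous_on {0..1} v" and Q: "quot_equicont v rat01"
  shows "quot_equicont v {0..1}"
  unfolding quot_equicont_def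
proof
  fix m
  obtain r where r: "\<And>s t s' t'. \<lbrakk>s \<in> rat01; t \<in> rat01; s' \<in> rat01; t' \<in> rat01; s \<noteq> t; s' \<noteq> t';
      \<bar>s - s'\<bar> < 1 / Suc r; \<bar>s - t\<bar> < 1 / Suc r; \<bar>s' - t'\<bar> < 1 / Suc r\<rbrakk> \<Longrightarrow>
     \<bar>diff_quot v s t - diff_quot v s' t'\<bar> \<le> 1 / Suc m"
    using Q unfolding quot_equicont_def by meson
  have "\<bar>diff_quot v s t - diff_quot v s' t'\<bar> \<le> 1 / Suc m"
    if in01: "s \<in> {0..1}" "t \<in> {0..1}" "s' \<in> {0..1}" "t' \<in> {0..1}"
      and ne: "s \<noteq> t" "s' \<noteq> t'"
      and near: "\<bar>s - s'\<bar> < 1 / Suc r" "\<bar>s - t\<bar> < 1 / Suc r" "\<bar>s' - t'\<bar> < 1 / Suc r" for s t s' t'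
  proof (rule tendsto_upperbound)
    let ?g = "\<lambda>t n. grid_approx n t"
    note lim = grid_approx_tendsto[OF in01(1)] grid_approx_tendsto[OF in01(2)]
      grid_approx_tendsto[OF in01(3)] grid_approx_tendsto[OF in01(4)]
    show "(\<lambda>n. \<bar>diff_quot v (?g s n) (?g t n) - diff_quot v (?g s' n) (?g t' n)\<bar>) \<longlonglongrightarrow>
        \<bar>diff_quot v s t - diff_quot v s' t'\<bar>"
      unfolding diff_quot_def using in01 ne
      by (intro tendsto_intros continuous_grid_approx[OF v] lim) auto
    have "\<forall>\<^sub>F n in sequentially. ?g t n - ?g s n \<noteq> 0"
      by (rule tendsto_imp_eventually_ne[of _ "t - s"]) (use lim ne in \<open>auto intro!: tendsto_intros\<close>)
    moreover have "\<forall>\<^sub>F n in sequentially. ?g t' n - ?g s' n \<noteq> 0"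
      by (rule tendsto_imp_eventually_ne[of _ "t' - s'"]) (use lim ne in \<open>auto intro!: tendsto_intros\<close>)
    moreover have "\<forall>\<^sub>F n in sequentially. \<bar>?g s n - ?g s' n\<bar> < 1 / Suc r"
      by (rule order_tendstoD(2)[OF _ near(1)]) (intro tendsto_intros lim)
    moreover have "\<forall>\<^sub>F n in sequentially. \<bar>?g s n - ?g t n\<bar> < 1 / Suc r"
      by (rule order_tendstoD(2)[OF _ near(2)]) (intro tendsto_intros lim)
    moreover have "\<forall>\<^sub>F n in sequentially. \<bar>?g s' n - ?g t' n\<bar> < 1 / Suc r"
      by (rule order_tendstoD(2)[OF _ near(3)]) (intro tendsto_intros lim)
    ultimately show "\<forall>\<^sub>F n in sequentially.
        \<bar>diff_quot v (?g s n) (?g t n) - diff_quot v (?g s' n) (?g t' n)\<bar> \<le> 1 / Suc m"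
      by eventually_elim (intro r grid_approx_in_rat01, auto)
  qed simp
  then show "\<exists>r::nat. \<forall>s\<in>{0..1}. \<forall>t\<in>{0..1}. \<forall>s'\<in>{0..1}. \<forall>t'\<in>{0..1}.
     s \<noteq> t \<and> s' \<noteq> t' \<and> \<bar>s - s'\<bar> < 1 / Suc r \<and> \<bar>s - t\<bar> < 1 / Suc r \<and> \<bar>s' - t'\<bar> < 1 / Suc r \<longrightarrow>
     \<bar>diff_quot v s t - diff_quot v s' t'\<bar> \<le> 1 / Suc m" by blast
qed

text \<open>A step of length at most 1/2 towards the farther end stays in the interval. Thus every
  point, end points included, is a limit of points of \<open>{0..1}\<close> different from
  it.\<close>

definition shift01 :: "real \<Rightarrow> nat \<Rightarrow> real" where
  "shift01 x n = (if x < 1/2 then x + 1 / real (n + 2) else x - 1 / real (n + 2))"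

lemma shift01_props:
  assumes "x \<in> {0..1}"
  shows "shift01 x n \<in> {0..1}" "shift01 x n \<noteq> x" "shift01 x \<longlonglongrightarrow> x"
proof -
  define h where "h = 1 / real (n + 2)"
  have "h \<le> 1/2" "h > 0" by (auto simp: field_simps h_def)
  then show "shift01 x n \<in> {0..1}" "shift01 x n \<noteq> x"
    using assms unfolding shift01_def h_def[symmetric] by auto
  have l: "(\<lambda>n. 1 / real (n + 2)) \<longlonglongrightarrow> 0"
    using lim_1_over_n by (rule LIMSEQ_ignore_initial_segment)
  show "shift01 x \<longlonglongrightarrow> x"
    unfolding shift01_def using tendsto_add[OF tendsto_const l, of x] tendsto_diff[OF tendsto_const l, of x]
    by (cases "x < 1/2") auto
qed

text \<open>Writes a derivative as the limit of a sequence of expressions in point evaluations, the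
  form in which measurability passes from \<open>D01 k\<close> to
  \<open>D01 (Suc k)\<close>.\<close>

lemma diff_quot_shift01_tendsto:
  assumes "(v has_real_derivative d) (at x within {0..1})" "x \<in> {0..1}"
  shows "(\<lambda>n. diff_quot v x (shift01 x n)) \<longlonglongrightarrow> d"
proof -
  have "((\<lambda>y. diff_quot v x y) \<longlongrightarrow> d) (at x within {0..1})"
    using assms(1) unfolding has_field_derivative_iff diff_quot_def .
  moreover have "filterlim (shift01 x) (at x within {0..1}) sequentially"
    unfolding filterlim_at using shift01_props[OF assms(2)] by auto
  ultimately show ?thesis by (rule filterlim_compose)
qed

text \<open>The mean value theorem with no order between the two points, so that its many uses need
  no case distinction. For \<open>s = t\<close> any derivative value serves.\<close>

lemma mvt01:
  fixes w :: "real \<Rightarrow> real"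
  assumes d: "\<And>x. x \<in> {0..1} \<Longrightarrow> (w has_real_derivative w' x) (at x within {0..1})"
    and st: "s \<in> {0..1}" "t \<in> {0..1}"
  obtains z where "min s t \<le> z" "z \<le> max s t" "w t - w s = w' z * (t - s)"
proof -
  have *: "\<exists>z\<ge>s. z \<le> t \<and> w t - w s = w' z * (t - s)"
    if "s \<in> {0..1}" "t \<in> {0..1}" "s < t" for s t
  proof -
    have "\<exists>z\<in>{s<..<t}. w t - w s = (\<lambda>h. w' z * h) (t - s)"
    proof (rule mvt_simple[OF \<open>s < t\<close>])
      fix z assume "s \<le> z" "z \<le> t"
      then show "(w has_derivative (\<lambda>h. w' z * h)) (at z within {s..t})"
        using has_derivative_subset[OF d[of z, unfolded has_field_derivative_def]] that by auto
    qed
    then show ?thesis by (meson greaterThanLessThan_iff less_imp_le)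
  qed
  consider "s < t" | "t < s" | "s = t" by linarith
  then show thesis
  proof cases
    case 1
    then show ?thesis using *[OF st 1] that by auto
  next
    case 2
    then obtain z where "z \<ge> t" "z \<le> s" "w s - w t = w' z * (s - t)" using *[OF st(2,1) 2] by auto
    then show ?thesis using that[of z] 2 by (auto simp: algebra_simps)
  qed (use that[of s] in auto)
qed

text \<open>By the mean value theorem each difference quotient is a value of \<open>w\<close> at a
  point in between, so uniform continuity of \<open>w\<close> on the compact interval controls the
  quotients.\<close>

lemma C1_imp_quot_equicont:
  assumes d: "\<And>x. x \<in> {0..1} \<Longrightarrow> (v has_real_derivative w x) (at x within {0..1})"
    and w: "continuous_on {0..1} w"
  shows "quot_equicont v {0..1}"
  unfolding quot_equicont_def
proof
  fix m :: nat
  have "uniformly_continuous_on {0..1} w"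
    by (rule compact_uniformly_continuous[OF w]) simp
  then obtain \<delta> where \<delta>: "\<delta> > 0"
    "\<And>x y. x \<in> {0..1} \<Longrightarrow> y \<in> {0..1} \<Longrightarrow> dist y x < \<delta> \<Longrightarrow> dist (w y) (w x) < 1 / Suc m"
    unfolding uniformly_continuous_on_def by (metis of_nat_0_less_iff zero_less_Suc zero_less_divide_1_iff)
  \<comment> \<open>Two intermediate points are linked by three distances, each below
    \<open>1 / Suc r\<close>.\<close>
  obtain r :: nat where r: "1 / Suc r < \<delta> / 3"
    using \<delta>(1) nat_approx_posE[of "\<delta>/3"] by auto
  have mvt: "\<exists>z. min s t \<le> z \<and> z \<le> max s t \<and> diff_quot v s t = w z"
    if "s \<in> {0..1}" "t \<in> {0..1}" "s \<noteq> t" for s t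
    using mvt01[OF d that(1,2)] that(3) unfolding diff_quot_def
    by (metis eq_iff_diff_eq_0 nonzero_mult_div_cancel_right)
  have "\<bar>diff_quot v s t - diff_quot v s' t'\<bar> \<le> 1 / Suc m"
    if in01: "s \<in> {0..1}" "t \<in> {0..1}" "s' \<in> {0..1}" "t' \<in> {0..1}"
      and ne: "s \<noteq> t" "s' \<noteq> t'"
      and near: "\<bar>s - s'\<bar> < 1 / Suc r" "\<bar>s - t\<bar> < 1 / Suc r" "\<bar>s' - t'\<bar> < 1 / Suc r" for s t s' t'
  proof -
    obtain z where z: "min s t \<le> z" "z \<le> max s t" "diff_quot v s t = w z"
      using mvt in01 ne by blast
    obtain z' where z': "min s' t' \<le> z'" "z' \<le> max s' t'" "diff_quot v s' t' = w z'"
      using mvt in01 ne by blast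
    have "\<bar>z - z'\<bar> < \<delta>" using z z' near r by linarith
    then have "dist (w z) (w z') < 1 / Suc m"
      by (intro \<delta>(2)) (use z z' in01 in \<open>auto simp: dist_real_def min_def max_def split: if_splits\<close>)
    then show ?thesis using z z' by (simp add: dist_real_def)
  qed
  then show "\<exists>r::nat. \<forall>s\<in>{0..1}. \<forall>t\<in>{0..1}. \<forall>s'\<in>{0..1}. \<forall>t'\<in>{0..1}.
     s \<noteq> t \<and> s' \<noteq> t' \<and> \<bar>s - s'\<bar> < 1 / Suc r \<and> \<bar>s - t\<bar> < 1 / Suc r \<and> \<bar>s' - t'\<bar> < 1 / Suc r \<longrightarrow>
     \<bar>diff_quot v s t - diff_quot v s' t'\<bar> \<le> 1 / Suc m" by blast
qed

text \<open>The quotients along \<open>shift01\<close> form a Cauchy sequence. Their limit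
  \<open>w\<close> is uniformly close to all nearby quotients over short intervals, and this one
  estimate yields both the derivative and its continuity.\<close>

lemma quot_equicont_imp_C1:
  assumes Q: "quot_equicont v {0..1}"
  obtains w where "\<And>x. x \<in> {0..1} \<Longrightarrow> (v has_real_derivative w x) (at x within {0..1})"
    "continuous_on {0..1} w"
proof -
  have Q': "\<exists>\<delta>>0. \<forall>s\<in>{0..1}. \<forall>t\<in>{0..1}. \<forall>s'\<in>{0..1}. \<forall>t'\<in>{0..1}.
     s \<noteq> t \<and> s' \<noteq> t' \<and> \<bar>s - s'\<bar> < \<delta> \<and> \<bar>s - t\<bar> < \<delta> \<and> \<bar>s' - t'\<bar> < \<delta> \<longrightarrow>
     \<bar>diff_quot v s t - diff_quot v s' t'\<bar> \<le> e" if e: "e > 0" for e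
  proof -
    obtain m :: nat where m: "1 / Suc m < e" using nat_approx_posE[OF e] by auto
    obtain r :: nat where r: "\<forall>s\<in>{0..1}. \<forall>t\<in>{0..1}. \<forall>s'\<in>{0..1}. \<forall>t'\<in>{0..1}.
     s \<noteq> t \<and> s' \<noteq> t' \<and> \<bar>s - s'\<bar> < 1 / Suc r \<and> \<bar>s - t\<bar> < 1 / Suc r \<and> \<bar>s' - t'\<bar> < 1 / Suc r \<longrightarrow>
     \<bar>diff_quot v s t - diff_quot v s' t'\<bar> \<le> 1 / Suc m"
      using Q unfolding quot_equicont_def by blast
    have "1 / real (Suc r) > 0" by simp
    then show ?thesis using r m by (meson less_imp_le order_trans)
  qed
  define w where "w x = lim (\<lambda>n. diff_quot v x (shift01 x n))" for x
  have w: "(\<lambda>n. diff_quot v x (shift01 x n)) \<longlonglongrightarrow> w x" if x: "x \<in> {0..1}" for x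
  proof -
    have "Cauchy (\<lambda>n. diff_quot v x (shift01 x n))"
    proof (rule metric_CauchyI)
      fix e :: real assume "e > 0"
      then obtain \<delta> where \<delta>: "\<delta> > 0" "\<forall>s\<in>{0..1}. \<forall>t\<in>{0..1}. \<forall>s'\<in>{0..1}. \<forall>t'\<in>{0..1}.
       s \<noteq> t \<and> s' \<noteq> t' \<and> \<bar>s - s'\<bar> < \<delta> \<and> \<bar>s - t\<bar> < \<delta> \<and> \<bar>s' - t'\<bar> < \<delta> \<longrightarrow>
       \<bar>diff_quot v s t - diff_quot v s' t'\<bar> \<le> e/2" using Q'[of "e/2"] by auto
      obtain M where M: "\<And>n. n \<ge> M \<Longrightarrow> dist (shift01 x n) x < \<delta>"
        using shift01_props(3)[OF x] \<delta>(1) unfolding LIMSEQ_def by blast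
      have "dist (diff_quot v x (shift01 x i)) (diff_quot v x (shift01 x j)) < e" 
        if "i \<ge> M" "j \<ge> M" for i j
      proof -
        have "\<bar>diff_quot v x (shift01 x i) - diff_quot v x (shift01 x j)\<bar> \<le> e/2"
          using \<delta> x shift01_props(1)[OF x, of i] shift01_props(1)[OF x, of j] 
            shift01_props(2)[OF x, of i] shift01_props(2)[OF x, of j] M[OF that(1)] M[OF that(2)]
          by (simp add: dist_real_def abs_minus_commute)
        then show ?thesis using \<open>e > 0\<close> by (simp add: dist_real_def)
      qed
      then show "\<exists>M. \<forall>m\<ge>M. \<forall>n\<ge>M. dist (diff_quot v x (shift01 x m)) (diff_quot v x (shift01 x n)) < e"
        by blast
    qed
    then show ?thesis unfolding w_def by (simp add: Cauchy_convergent_iff convergent_LIMSEQ_iff)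
  qed
  \<comment> \<open>The base point \<open>s\<close> may differ from \<open>x\<close>. Taking
    \<open>s = x\<close> gives the derivative, and comparing one quotient with \<open>w\<close> at
    two points gives continuity.\<close>
  have near: "\<exists>\<delta>>0. \<forall>s\<in>{0..1}. \<forall>t\<in>{0..1}. \<forall>x\<in>{0..1}. s \<noteq> t \<and> \<bar>s - x\<bar> < \<delta> \<and> \<bar>s - t\<bar> < \<delta> \<longrightarrow>
     \<bar>diff_quot v s t - w x\<bar> \<le> e" if "e > 0" for e
  proof -
    obtain \<delta> where \<delta>: "\<delta> > 0" "\<forall>s\<in>{0..1}. \<forall>t\<in>{0..1}. \<forall>s'\<in>{0..1}. \<forall>t'\<in>{0..1}.
       s \<noteq> t \<and> s' \<noteq> t' \<and> \<bar>s - s'\<bar> < \<delta> \<and> \<bar>s - t\<bar> < \<delta> \<and> \<bar>s' - t'\<bar> < \<delta> \<longrightarrow>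
       \<bar>diff_quot v s t - diff_quot v s' t'\<bar> \<le> e" using Q'[OF \<open>e > 0\<close>] by blast
    have "\<bar>diff_quot v s t - w x\<bar> \<le> e" if "s \<in> {0..1}" "t \<in> {0..1}" "x \<in> {0..1}" "s \<noteq> t" 
      "\<bar>s - x\<bar> < \<delta>" "\<bar>s - t\<bar> < \<delta>" for s t x
    proof (rule tendsto_upperbound)
      show "(\<lambda>n. \<bar>diff_quot v s t - diff_quot v x (shift01 x n)\<bar>) \<longlonglongrightarrow> \<bar>diff_quot v s t - w x\<bar>"
        by (intro tendsto_intros w that)
      have "\<forall>\<^sub>F n in sequentially. dist (shift01 x n) x < \<delta>"
        using shift01_props(3)[OF \<open>x \<in> _\<close>] \<delta>(1) by (rule tendstoD)
      then show "\<forall>\<^sub>F n in sequentially. \<bar>diff_quot v s t - diff_quot v x (shift01 x n)\<bar> \<le> e"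
      proof eventually_elim
        case (elim n)
        have "\<bar>x - shift01 x n\<bar> < \<delta>" using elim by (simp add: dist_real_def abs_minus_commute)
        then show ?case 
          using \<delta>(2)[rule_format, of s t x "shift01 x n"] that shift01_props(1,2)[OF \<open>x \<in> _\<close>, of n] by auto
      qed
    qed simp
    then show ?thesis using \<delta>(1) by blast
  qed
  have der: "(v has_real_derivative w x) (at x within {0..1})" if x: "x \<in> {0..1}" for x
    unfolding has_field_derivative_iff
  proof (rule tendstoI)
    fix e :: real assume "e > 0"
    then obtain \<delta> where \<delta>: "\<delta> > 0" "\<forall>s\<in>{0..1}. \<forall>t\<in>{0..1}. \<forall>x\<in>{0..1}. 
      s \<noteq> t \<and> \<bar>s - x\<bar> < \<delta> \<and> \<bar>s - t\<bar> < \<delta> \<longrightarrow> \<bar>diff_quot v s t - w x\<bar> \<le> e/2"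
      using near[of "e/2"] by auto
    have "dist ((v y - v x) / (y - x)) (w x) < e" if "y \<in> {0..1}" "y \<noteq> x" "dist y x < \<delta>" for y
      using \<delta>(2)[rule_format, of x y x] that x \<delta>(1) \<open>e > 0\<close>
      by (auto simp: dist_real_def diff_quot_def abs_minus_commute)
    then show "\<forall>\<^sub>F y in at x within {0..1}. dist ((v y - v x) / (y - x)) (w x) < e"
      unfolding eventually_at using \<delta>(1) by blast
  qed
  have "continuous_on {0..1} w"
    unfolding continuous_on_iff
  proof (intro ballI allI impI)
    fix x e :: real assume x: "x \<in> {0..1}" and "e > 0"
    then obtain \<delta> where \<delta>: "\<delta> > 0" "\<forall>s\<in>{0..1}. \<forall>t\<in>{0..1}. \<forall>x\<in>{0..1}. 
      s \<noteq> t \<and> \<bar>s - x\<bar> < \<delta> \<and> \<bar>s - t\<bar> < \<delta> \<longrightarrow> \<bar>diff_quot v s t - w x\<bar> \<le> e/3"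
      using near[of "e/3"] by auto
    have "dist (w y) (w x) < e" if y: "y \<in> {0..1}" and d: "dist y x < \<delta>" for y
    proof -
      have "\<forall>\<^sub>F n in sequentially. dist (shift01 x n) x < \<delta>"
        using shift01_props(3)[OF x] \<delta>(1) by (rule tendstoD)
      then obtain n where n: "dist (shift01 x n) x < \<delta>"
        using eventually_happens'[OF sequentially_bot] by blast
      let ?t = "shift01 x n"
      have "\<bar>diff_quot v x ?t - w y\<bar> \<le> e/3" "\<bar>diff_quot v x ?t - w x\<bar> \<le> e/3"
        using \<delta>(2)[rule_format, of x ?t y] \<delta>(2)[rule_format, of x ?t x] shift01_props(1,2)[OF x, of n]
          \<delta>(1) n x y d
        by (auto simp: dist_real_def abs_minus_commute)
      then show ?thesis using \<open>e > 0\<close> unfolding dist_real_def by argo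
    qed
    then show "\<exists>d>0. \<forall>x'\<in>{0..1}. dist x' x < d \<longrightarrow> dist (w x') (w x) < e"
      using \<delta>(1) by blast
  qed
  with der that show thesis by blast
qed

text \<open>The left side quantifies over uncountably many points. For continuous \<open>v\<close>
  it reduces to a condition on countably many evaluations, so that for random \<open>v\<close> it
  defines an event.\<close>

lemma C1_iff_quot_equicont:
  assumes "continuous_on {0..1} v"
  shows "(\<forall>x\<in>{0..1}. v differentiable (at x within {0..1})) \<and>
      continuous_on {0..1} (\<lambda>x. vector_derivative v (at x within {0..1})) \<longleftrightarrow>
    quot_equicont v rat01"
proof
  assume L: "(\<forall>x\<in>{0..1}. v differentiable (at x within {0..1})) \<and>
      continuous_on {0..1} (\<lambda>x. vector_derivative v (at x within {0..1}))"
  then have "quot_equicont v {0..1}"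
    by (intro C1_imp_quot_equicont[where w = "\<lambda>x. vector_derivative v (at x within {0..1})"])
      (auto simp: has_real_derivative_iff_has_vector_derivative vector_derivative_works[symmetric])
  then show "quot_equicont v rat01"
    using rat01_subset unfolding quot_equicont_def by (meson subsetD)
next
  assume "quot_equicont v rat01"
  then have "quot_equicont v {0..1}" by (rule quot_equicont_extend[OF assms])
  then obtain w where w: "\<And>x. x \<in> {0..1} \<Longrightarrow> (v has_real_derivative w x) (at x within {0..1})"
    "continuous_on {0..1} w" by (rule quot_equicont_imp_C1) blast
  have "continuous_on {0..1} (\<lambda>x. vector_derivative v (at x within {0..1}))"
    by (rule continuous_on_eq[OF w(2)]) (use vector_derivative_01_eq[OF w(1)] in auto)
  with w(1) show "(\<forall>x\<in>{0..1}. v differentiable (at x within {0..1})) \<and>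
      continuous_on {0..1} (\<lambda>x. vector_derivative v (at x within {0..1}))"
    using real_differentiable_def by blast
qed

section \<open>Measurability of Hoelder balls\<close>

lemma pred_Ball_countable:
  assumes "countable X" "\<And>i. i \<in> X \<Longrightarrow> Measurable.pred M (\<lambda>x. P x i)"
  shows "Measurable.pred M (\<lambda>x. \<forall>i\<in>X. P x i)"
  using sets.sets_Collect_countable_All'[of X M "\<lambda>i x. P x i"] assms by (simp add: pred_def)

text \<open>Both claims go through one induction: the set for \<open>Suc k\<close> is described by
  quotients of \<open>D01 k\<close>, and on that set \<open>D01 (Suc k)\<close> is a limit of such
  quotients. The restriction to the set matters because elsewhere \<open>vector_derivative\<close>
  need not be a limit of quotients.\<close>

lemma sets_Ck01:
  fixes u :: "'b \<Rightarrow> real \<Rightarrow> real"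
  assumes cont: "\<And>b. b \<in> space M \<Longrightarrow> continuous_on {0..1} (u b)"
    and meas: "\<And>x. x \<in> {0..1} \<Longrightarrow> (\<lambda>b. u b x) \<in> borel_measurable M"
  shows "{b \<in> space M. Ck01 k (u b)} \<in> sets M" (is "?S k \<in> _")
    and "\<And>j x. j \<le> k \<Longrightarrow> x \<in> {0..1} \<Longrightarrow>
      (\<lambda>b. D01 j (u b) x) \<in> borel_measurable (restrict_space M {b \<in> space M. Ck01 k (u b)})"
proof -
  have "?S k \<in> sets M \<and> (\<forall>j\<le>k. \<forall>x\<in>{0..1}.
      (\<lambda>b. D01 j (u b) x) \<in> borel_measurable (restrict_space M (?S k)))"
  proof (induction k)
    case 0
    have "?S 0 = space M" using cont by (auto simp: Ck01_def)
    then show ?case using meas by (auto intro!: measurable_restrict_space1)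
  next
    case (Suc k)
    define N where "N = restrict_space M (?S k)"
    have Sk: "?S k \<in> sets M" using Suc.IH by blast
    have space_N: "space N = ?S k" unfolding N_def space_restrict_space by blast
    have mN: "(\<lambda>b. D01 j (u b) x) \<in> borel_measurable N" if "j \<le> k" "x \<in> {0..1}" for j x
      using Suc.IH that unfolding N_def by blast
    have eq: "?S (Suc k) = {b \<in> space N. quot_equicont (D01 k (u b)) rat01}"
      unfolding space_N Ck01_Suc
      using C1_iff_quot_equicont[OF Ck01_continuous_on[OF _ order.refl]] by blast
    have "Measurable.pred N (\<lambda>b. quot_equicont (D01 k (u b)) rat01)"
      unfolding quot_equicont_def diff_quot_def
    proof (intro pred_intros_countable(1,2) pred_Ball_countable countable_rat01)
      fix m r :: nat and s t s' t' assume *: "s \<in> rat01" "t \<in> rat01" "s' \<in> rat01" "t' \<in> rat01"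
      have [measurable]: "(\<lambda>b. D01 k (u b) s) \<in> borel_measurable N"
        "(\<lambda>b. D01 k (u b) t) \<in> borel_measurable N" "(\<lambda>b. D01 k (u b) s') \<in> borel_measurable N"
        "(\<lambda>b. D01 k (u b) t') \<in> borel_measurable N"
        using * rat01_subset by (auto intro!: mN)
      show "Measurable.pred N (\<lambda>b. s \<noteq> t \<and> s' \<noteq> t' \<and> \<bar>s - s'\<bar> < 1 / real (Suc r) \<and>
          \<bar>s - t\<bar> < 1 / real (Suc r) \<and> \<bar>s' - t'\<bar> < 1 / real (Suc r) \<longrightarrow>
          \<bar>(D01 k (u b) t - D01 k (u b) s) / (t - s) - (D01 k (u b) t' - D01 k (u b) s') / (t' - s')\<bar>
            \<le> 1 / real (Suc m))"
        by measurable
    qed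
    then have S: "?S (Suc k) \<in> sets N" unfolding eq pred_def .
    then have SM: "?S (Suc k) \<in> sets M"
      unfolding N_def using Sk by (subst (asm) sets_restrict_space_iff) auto
    define N' where "N' = restrict_space M (?S (Suc k))"
    have space_N': "space N' = ?S (Suc k)" unfolding N'_def space_restrict_space by blast
    have N': "N' = restrict_space N (?S (Suc k))"
      unfolding N'_def N_def restrict_restrict_space[OF _ ] using Ck01_mono[of "Suc k" _ k] Sk SM
      by (subst restrict_restrict_space) (auto intro: arg_cong[where f="restrict_space M"])
    have mN': "(\<lambda>b. D01 j (u b) x) \<in> borel_measurable N'" if "j \<le> k" "x \<in> {0..1}" for j x
      unfolding N' by (rule measurable_restrict_space1[OF mN[OF that]])
    have "(\<lambda>b. D01 (Suc k) (u b) x) \<in> borel_measurable N'" if x: "x \<in> {0..1}" for x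
    proof (rule borel_measurable_LIMSEQ_real)
      show "(\<lambda>b. diff_quot (D01 k (u b)) x (shift01 x n)) \<in> borel_measurable N'" for n
        unfolding diff_quot_def using x shift01_props(1)[OF x, of n]
        by (intro borel_measurable_divide borel_measurable_diff mN' borel_measurable_const) auto
      show "(\<lambda>n. diff_quot (D01 k (u b)) x (shift01 x n)) \<longlonglongrightarrow> D01 (Suc k) (u b) x"
        if "b \<in> space N'" for b
        using that x unfolding space_N'
        by (intro diff_quot_shift01_tendsto Ck01_has_derivative[of "Suc k"]) auto
    qed
    with mN' SM show ?case unfolding N'_def by (auto simp: le_Suc_eq)
  qed
  then show "?S k \<in> sets M" "\<And>j x. j \<le> k \<Longrightarrow> x \<in> {0..1} \<Longrightarrow>
      (\<lambda>b. D01 j (u b) x) \<in> borel_measurable (restrict_space M (?S k))" by blast+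
qed

text \<open>Continuity lets a countable supremum replace the uncountable one, which makes it
  measurable when \<open>g\<close> is random.\<close>

lemma SUP_rat01:
  assumes "continuous_on {0..1} g"
  shows "(SUP x\<in>{0..1}. ennreal \<bar>g x\<bar>) = (SUP x\<in>rat01. ennreal \<bar>g x\<bar>)"
proof (rule antisym)
  show "(SUP x\<in>{0..1}. ennreal \<bar>g x\<bar>) \<le> (SUP x\<in>rat01. ennreal \<bar>g x\<bar>)"
  proof (rule SUP_least)
    fix x :: real assume x: "x \<in> {0..1}"
    have "(\<lambda>n. ennreal \<bar>g (grid_approx n x)\<bar>) \<longlonglongrightarrow> ennreal \<bar>g x\<bar>"
      by (intro tendsto_ennrealI tendsto_intros continuous_grid_approx[OF assms x])
    then show "ennreal \<bar>g x\<bar> \<le> (SUP x\<in>rat01. ennreal \<bar>g x\<bar>)"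
      by (rule LIMSEQ_le_const2) (intro exI allI impI SUP_upper grid_approx_in_rat01)
  qed
  show "(SUP x\<in>rat01. ennreal \<bar>g x\<bar>) \<le> (SUP x\<in>{0..1}. ennreal \<bar>g x\<bar>)"
    by (rule SUP_subset_mono) (auto simp: rat01_def)
qed

text \<open>The quotient is continuous off the diagonal, and the approximants of two distinct points
  are eventually distinct.\<close>

lemma SUP_rat01_pairs:
  fixes g :: "real \<Rightarrow> real"
  assumes "continuous_on {0..1} g"
  shows "(SUP (s, t)\<in>{(s, t). s \<in> {0..1} \<and> t \<in> {0..1} \<and> s \<noteq> t}.
            ennreal (\<bar>g s - g t\<bar> / \<bar>s - t\<bar> powr \<alpha>)) =
         (SUP (s, t)\<in>{(s, t). s \<in> rat01 \<and> t \<in> rat01 \<and> s \<noteq> t}.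
            ennreal (\<bar>g s - g t\<bar> / \<bar>s - t\<bar> powr \<alpha>))" (is "?L = ?R")
proof (rule antisym)
  show "?L \<le> ?R"
  proof (rule SUP_least, clarify)
    fix s t :: real assume s: "s \<in> {0..1}" and t: "t \<in> {0..1}" and ne: "s \<noteq> t"
    let ?s = "\<lambda>n. grid_approx n s" and ?t = "\<lambda>n. grid_approx n t"
    have lim: "(\<lambda>n. ennreal (\<bar>g (?s n) - g (?t n)\<bar> / \<bar>?s n - ?t n\<bar> powr \<alpha>)) \<longlonglongrightarrow>
        ennreal (\<bar>g s - g t\<bar> / \<bar>s - t\<bar> powr \<alpha>)"
      using ne by (intro tendsto_ennrealI tendsto_intros continuous_grid_approx[OF assms]
          grid_approx_tendsto s t) auto
    have "\<forall>\<^sub>F n in sequentially. ?s n - ?t n \<noteq> 0"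
      by (rule tendsto_imp_eventually_ne[of _ "s - t"])
        (use ne s t in \<open>auto intro!: tendsto_intros grid_approx_tendsto\<close>)
    then have "\<forall>\<^sub>F n in sequentially.
        ennreal (\<bar>g (?s n) - g (?t n)\<bar> / \<bar>?s n - ?t n\<bar> powr \<alpha>) \<le> ?R"
    proof eventually_elim
      case (elim n)
      then have "(?s n, ?t n) \<in> {(s, t). s \<in> rat01 \<and> t \<in> rat01 \<and> s \<noteq> t}"
        using grid_approx_in_rat01 by auto
      then show ?case by (rule SUP_upper2) simp
    qed
    then show "ennreal (\<bar>g s - g t\<bar> / \<bar>s - t\<bar> powr \<alpha>) \<le> ?R"
      by (rule tendsto_upperbound[OF lim]) simp
  qed
  show "?R \<le> ?L"
    by (rule SUP_subset_mono) (auto simp: rat01_def)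
qed

text \<open>The norm is infinite off the measurable set where \<open>Ck01\<close> holds, so the
  sublevel set lies inside it. There the norm is a combination of countable suprema of measurable
  functions.\<close>

lemma sets_holder_norm_less:
  fixes u :: "'b \<Rightarrow> real \<Rightarrow> real"
  assumes cont: "\<And>b. b \<in> space M \<Longrightarrow> continuous_on {0..1} (u b)"
    and meas: "\<And>x. x \<in> {0..1} \<Longrightarrow> (\<lambda>b. u b x) \<in> borel_measurable M"
  shows "{b \<in> space M. holder_norm \<gamma> (u b) < ennreal \<epsilon>} \<in> sets M"
proof -
  define k where "k = nat \<lfloor>\<gamma>\<rfloor>"
  define S where "S = {b \<in> space M. Ck01 k (u b)}"
  define N where "N = restrict_space M S"
  have S: "S \<in> sets M" unfolding S_def by (rule sets_Ck01) (use assms in auto)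
  have space_N: "space N = S" unfolding N_def space_restrict_space S_def by blast
  have mN[measurable]: "(\<lambda>b. D01 j (u b) x) \<in> borel_measurable N" if "j \<le> k" "x \<in> rat01" for j x
    unfolding N_def S_def by (rule sets_Ck01) (use assms rat01_subset that in auto)
  define h where "h b = (\<Sum>j\<le>k. SUP x\<in>rat01. ennreal \<bar>D01 j (u b) x\<bar>) +
        (if frac \<gamma> = 0 then 0
         else SUP (s, t)\<in>{(s, t). s \<in> rat01 \<and> t \<in> rat01 \<and> s \<noteq> t}.
                ennreal (\<bar>D01 k (u b) s - D01 k (u b) t\<bar> / \<bar>s - t\<bar> powr frac \<gamma>))" for b
  have "countable {(s, t). s \<in> rat01 \<and> t \<in> rat01 \<and> s \<noteq> t}"
    by (rule countable_subset[of _ "rat01 \<times> rat01"]) (auto simp: countable_rat01)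
  then have "h \<in> borel_measurable N"
    unfolding h_def case_prod_beta
    by (intro borel_measurable_add borel_measurable_sum borel_measurable_SUP countable_rat01
        measurable_If measurable_compose[OF _ measurable_ennreal] borel_measurable_abs mN
        borel_measurable_divide borel_measurable_diff borel_measurable_const) auto
  then have "{b \<in> space N. h b < ennreal \<epsilon>} \<in> sets N" by measurable
  moreover have "{b \<in> space M. holder_norm \<gamma> (u b) < ennreal \<epsilon>} = {b \<in> space N. h b < ennreal \<epsilon>}"
  proof -
    have "holder_norm \<gamma> (u b) = h b" if "b \<in> S" for b
    proof -
      have C: "Ck01 k (u b)" using that by (simp add: S_def)
      have "(\<Sum>j\<le>k. SUP x\<in>{0..1}. ennreal \<bar>D01 j (u b) x\<bar>) = (\<Sum>j\<le>k. SUP x\<in>rat01. ennreal \<bar>D01 j (u b) x\<bar>)"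
        by (intro sum.cong refl SUP_rat01 Ck01_continuous_on[OF C]) auto
      then show ?thesis
        unfolding holder_norm_def h_def Let_def k_def[symmetric]
        using C SUP_rat01_pairs[OF Ck01_continuous_on[OF C order.refl]] by simp
    qed
    moreover have "b \<in> S" if "b \<in> space M" "holder_norm \<gamma> (u b) < ennreal \<epsilon>" for b
      using that unfolding S_def holder_norm_def Let_def k_def by (auto split: if_splits)
    ultimately show ?thesis unfolding space_N by (metis (lifting) S_def mem_Collect_eq)
  qed
  ultimately show ?thesis
    unfolding N_def using S by (subst (asm) sets_restrict_space_iff) auto
qed

lemma sets_holder_ball:
  assumes "prior_measure \<mu>" "continuous_on {0..1} a"
  shows "holder_ball \<mu> \<gamma> a \<epsilon> \<in> sets \<mu>"
  unfolding holder_ball_def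
proof (rule sets_holder_norm_less)
  show "continuous_on {0..1} (\<lambda>t. b t - a t)" if "b \<in> space \<mu>" for b
    using assms that by (auto simp: prior_measure_def intro!: continuous_intros)
  show "(\<lambda>b. b x - a x) \<in> borel_measurable \<mu>" if "x \<in> {0..1}" for x
    using assms that
    by (auto simp: prior_measure_def intro!: borel_measurable_diff borel_measurable_const)
qed

section \<open>The elliptic boundary value problem\<close>

definition source_int :: "(real \<Rightarrow> real) \<Rightarrow> real \<Rightarrow> real" where
  "source_int f x = integral {0..x} f"

text \<open>Integrating the equation once gives \<open>a p' = C - F\<close> with
  \<open>F = source_int f\<close>. Dividing by \<open>a\<close> and requiring \<open>p\<close> to
  vanish at 1 forces this value of \<open>C\<close>.\<close>

definition flux_const :: "(real \<Rightarrow> real) \<Rightarrow> (real \<Rightarrow> real) \<Rightarrow> real" where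
  "flux_const f a = integral {0..1} (\<lambda>t. source_int f t / a t) / integral {0..1} (\<lambda>t. 1 / a t)"

definition elliptic_sol :: "(real \<Rightarrow> real) \<Rightarrow> (real \<Rightarrow> real) \<Rightarrow> real \<Rightarrow> real" where
  "elliptic_sol f a x = integral {0..x} (\<lambda>t. (flux_const f a - source_int f t) / a t)"

lemma source_int_deriv:
  assumes "continuous_on {0..1} f" "x \<in> {0..1}"
  shows "(source_int f has_real_derivative f x) (at x within {0..1})"
  unfolding source_int_def using integral_has_real_derivative[OF assms] by simp

lemma source_int_continuous:
  assumes "continuous_on {0..1} f"
  shows "continuous_on {0..1} (source_int f)"
  using source_int_deriv[OF assms] by (rule DERIV_continuous_on)

lemma continuous_on_divide_pos:
  fixes a g :: "real \<Rightarrow> real"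
  assumes "continuous_on S g" "continuous_on S a" "\<forall>t\<in>S. a t > 0"
  shows "continuous_on S (\<lambda>t. g t / a t)"
  by (rule continuous_on_divide) (use assms in auto)

lemma elliptic_sol_deriv:
  assumes f: "continuous_on {0..1} f" and a: "continuous_on {0..1} a" "\<forall>t\<in>{0..1}. a t > 0"
    and x: "x \<in> {0..1}"
  shows "(elliptic_sol f a has_real_derivative (flux_const f a - source_int f x) / a x) (at x within {0..1})"
  unfolding elliptic_sol_def
  by (rule integral_has_real_derivative[OF _ x])
    (intro continuous_on_divide_pos continuous_on_diff continuous_on_const source_int_continuous f a)

lemma elliptic_sol_0: "elliptic_sol f a 0 = 0"
  by (simp add: elliptic_sol_def)

text \<open>This integral is the denominator of \<open>flux_const\<close>. A nonnegative continuous
  function with integral zero vanishes identically, which \<open>1 / a\<close> does not.\<close>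

lemma integral_inverse_pos:
  fixes a :: "real \<Rightarrow> real"
  assumes a: "continuous_on {0..1} a" "\<forall>t\<in>{0..1}. a t > 0"
  shows "integral {0..1} (\<lambda>t. 1 / a t) > 0"
proof -
  have c: "continuous_on {0..1} (\<lambda>t. 1 / a t)" by (intro continuous_on_divide_pos continuous_on_const a)
  have nn: "0 \<le> 1 / a t" if "t \<in> {0..1}" for t using a(2) that by (simp add: less_imp_le)
  have "integral {0..1} (\<lambda>t. 1 / a t) \<ge> 0"
    by (intro Henstock_Kurzweil_Integration.integral_nonneg integrable_continuous_real c nn)
  moreover have "integral {0..1} (\<lambda>t. 1 / a t) \<noteq> 0"
  proof
    assume "integral {0..1} (\<lambda>t. 1 / a t) = 0"
    moreover have "(integral {0..1} (\<lambda>t. 1 / a t) = 0) = (\<forall>x\<in>{0..1}. 1 / a x = 0)"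
      by (rule integral_eq_0_iff[OF c]) (use nn in auto)
    ultimately have "1 / a 0 = 0" by simp
    moreover have "a 0 > 0" using bspec[OF a(2), of 0] by simp
    ultimately show False by simp
  qed
  ultimately show ?thesis by linarith
qed

lemma elliptic_sol_1:
  assumes f: "continuous_on {0..1} f" and a: "continuous_on {0..1} a" "\<forall>t\<in>{0..1}. a t > 0"
  shows "elliptic_sol f a 1 = 0"
proof -
  have c: "continuous_on {0..1} (\<lambda>t. 1 / a t)" by (intro continuous_on_divide_pos continuous_on_const a)
  have d: "continuous_on {0..1} (\<lambda>t. source_int f t / a t)"
    by (intro continuous_on_divide_pos source_int_continuous f a)
  have "elliptic_sol f a 1 =
      integral {0..1} (\<lambda>t. flux_const f a * (1 / a t) - source_int f t / a t)"
    unfolding elliptic_sol_def by (simp add: diff_divide_distrib)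
  also have "\<dots> = integral {0..1} (\<lambda>t. flux_const f a * (1 / a t)) - integral {0..1} (\<lambda>t. source_int f t / a t)"
    by (intro Henstock_Kurzweil_Integration.integral_diff integrable_continuous_real continuous_on_mult_left c d)
  also have "\<dots> = 0"
    unfolding Henstock_Kurzweil_Integration.integral_mult_right
    using integral_inverse_pos[OF a] by (simp add: flux_const_def)
  finally show ?thesis .
qed

text \<open>The flux \<open>a p'\<close> equals \<open>flux_const f a - source_int f\<close> on the
  open interval. It is this difference that is differentiated, never \<open>a\<close>
  itself.\<close>

lemma solves_elliptic_sol:
  assumes f: "continuous_on {0..1} f" and a: "continuous_on {0..1} a" "\<forall>t\<in>{0..1}. a t > 0"
  shows "solves_elliptic f a (restrict (elliptic_sol f a) {0..1})"
proof -
  let ?p = "restrict (elliptic_sol f a) {0..1}"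
  note d = elliptic_sol_deriv[OF f a]
  have "continuous_on {0..1} (elliptic_sol f a)"
    using d by (rule DERIV_continuous_on)
  then have c: "continuous_on {0..1} ?p" by (rule continuous_on_eq) auto
  have dp: "(?p has_real_derivative (flux_const f a - source_int f x) / a x) (at x)"
    if x: "x \<in> {0<..<1}" for x
  proof -
    have "(elliptic_sol f a has_real_derivative (flux_const f a - source_int f x) / a x) (at x)"
      using d[of x] x at_within_Icc_at[of 0 x 1] by auto
    then show ?thesis
      by (rule has_field_derivative_transform_within_open[OF _ _ x]) auto
  qed
  have "((\<lambda>t. a t * deriv ?p t) has_real_derivative - f x) (at x)" if x: "x \<in> {0<..<1}" for x
  proof (rule has_field_derivative_transform_within_open[OF _ _ x])
    have "(source_int f has_real_derivative f x) (at x)"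
      using source_int_deriv[OF f, of x] x at_within_Icc_at[of 0 x 1] by auto
    then show "((\<lambda>t. flux_const f a - source_int f t) has_real_derivative - f x) (at x)"
      by (auto intro!: derivative_eq_intros)
    show "flux_const f a - source_int f t = a t * deriv ?p t" if "t \<in> {0<..<1}" for t
    proof -
      have "a t \<noteq> 0" using bspec[OF a(2), of t] that by simp
      then show ?thesis using DERIV_imp_deriv[OF dp[OF that]] by simp
    qed
  qed simp
  moreover have "?p differentiable (at x)" if "x \<in> {0<..<1}" for x
    using dp[OF that] real_differentiable_def by blast
  ultimately show ?thesis
    unfolding solves_elliptic_def using c elliptic_sol_0 elliptic_sol_1[OF f a] by simp
qed

text \<open>The flux \<open>h\<close> of the difference \<open>w\<close> of two solutions has
  derivative zero and is constant. Rolle's theorem gives a point where \<open>w'\<close>, and with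
  it \<open>h\<close>, vanishes, so \<open>h = 0\<close>, \<open>w' = 0\<close> and \<open>w\<close>
  keeps its boundary value.\<close>

lemma solves_elliptic_unique:
  assumes p: "solves_elliptic f a p" and q: "solves_elliptic f a q"
    and a: "\<forall>t\<in>{0..1}. a t > 0" and x: "x \<in> {0..1}"
  shows "p x = q x"
proof -
  define w where "w t = p t - q t" for t
  have c: "continuous_on {0..1} w" and w01: "w 0 = 0" "w 1 = 0"
    using p q unfolding w_def solves_elliptic_def by (auto intro!: continuous_intros)
  have dw: "(w has_real_derivative deriv p t - deriv q t) (at t)" if "t \<in> {0<..<1}" for t
    using p q that unfolding w_def solves_elliptic_def real_differentiable_def
    by (intro DERIV_diff) (auto simp: DERIV_deriv_iff_real_differentiable real_differentiable_def)
  define h where "h t = a t * (deriv p t - deriv q t)" for t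
  have dh: "(h has_real_derivative 0) (at t)" if "t \<in> {0<..<1}" for t
  proof -
    have "((\<lambda>t. a t * deriv p t - a t * deriv q t) has_real_derivative - f t - - f t) (at t)"
      using p q that unfolding solves_elliptic_def by (intro DERIV_diff) auto
    moreover have "h = (\<lambda>t. a t * deriv p t - a t * deriv q t)"
      by (simp add: h_def fun_eq_iff right_diff_distrib)
    ultimately show ?thesis by simp
  qed
  obtain z where z: "0 < z" "z < 1" "(w has_real_derivative 0) (at z)"
    using Rolle[of 0 1 w] c w01 dw by (auto simp: real_differentiable_def)
  then have "deriv p z - deriv q z = 0" using DERIV_unique[OF dw z(3)] by auto
  then have hz: "h z = 0" by (simp add: h_def)
  obtain e where e: "\<And>t. t \<in> {0<..<1} \<Longrightarrow> h t = e"
    using has_field_derivative_zero_constant[of "{0<..<1}" h] dh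
    by (blast intro: has_field_derivative_at_within)
  have h0: "h t = 0" if t: "t \<in> {0<..<1}" for t
    using e[OF t] e[of z] hz z(1,2) by simp
  have dw0: "(w has_real_derivative 0) (at t)" if t: "t \<in> {0<..<1}" for t
  proof -
    have "a t \<noteq> 0" using bspec[OF a, of t] t by simp
    then have "deriv p t - deriv q t = 0" using h0[OF t] by (simp add: h_def)
    with dw[OF t] show ?thesis by simp
  qed
  have "w x = w 0"
    by (rule DERIV_isconst2[OF _ c]) (use dw0 x in auto)
  then show ?thesis using w01 by (simp add: w_def)
qed

text \<open>Resolves the definite description. Uniqueness holds pointwise on \<open>{0..1}\<close>,
  and extensionality upgrades it to equality of functions.\<close>

lemma forward_eq:
  assumes f: "continuous_on {0..1} f" and a: "continuous_on {0..1} a" "\<forall>t\<in>{0..1}. a t > 0"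
  shows "forward f a = restrict (elliptic_sol f a) {0..1}"
  unfolding forward_def
proof (rule the_equality)
  show "restrict (elliptic_sol f a) {0..1} \<in> extensional {0..1} \<and>
      solves_elliptic f a (restrict (elliptic_sol f a) {0..1})"
    using solves_elliptic_sol[OF f a] by auto
  show "p = restrict (elliptic_sol f a) {0..1}"
    if p: "p \<in> extensional {0..1} \<and> solves_elliptic f a p" for p
  proof (rule extensionalityI[of p "{0..1}"])
    show "p x = restrict (elliptic_sol f a) {0..1} x" if "x \<in> {0..1}" for x
      by (rule solves_elliptic_unique[OF _ solves_elliptic_sol[OF f a] a(2) that]) (use p in auto)
  qed (use p in auto)
qed

lemma forward_deriv:
  assumes f: "continuous_on {0..1} f" and a: "continuous_on {0..1} a" "\<forall>t\<in>{0..1}. a t > 0"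
    and x: "x \<in> {0..1}"
  shows "(forward f a has_real_derivative (flux_const f a - source_int f x) / a x) (at x within {0..1})"
  unfolding forward_eq[OF f a] has_field_derivative_def
  by (rule has_derivative_transform[OF x _ elliptic_sol_deriv[OF f a x, unfolded has_field_derivative_def]])
    simp

lemma forward_bdry:
  assumes f: "continuous_on {0..1} f" and a: "continuous_on {0..1} a" "\<forall>t\<in>{0..1}. a t > 0"
  shows "forward f a 0 = 0" "forward f a 1 = 0"
  using elliptic_sol_0 elliptic_sol_1[OF assms] by (auto simp: forward_eq[OF assms])

section \<open>Mean value and interpolation estimates on the interval\<close>

lemma Lipschitz01_deriv:
  fixes w :: "real \<Rightarrow> real"
  assumes d: "\<And>x. x \<in> {0..1} \<Longrightarrow> (w has_real_derivative w' x) (at x within {0..1})"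
    and b: "\<And>x. x \<in> {0..1} \<Longrightarrow> \<bar>w' x\<bar> \<le> B" and "s \<in> {0..1}" "t \<in> {0..1}"
  shows "\<bar>w s - w t\<bar> \<le> B * \<bar>s - t\<bar>"
  using field_differentiable_bound[of "{0..1}" w w' B s t] assms by auto

lemma Rolle01:
  assumes d: "\<And>x. x \<in> {0..1} \<Longrightarrow> (w has_real_derivative w' x) (at x within {0..1})"
    and w: "w 0 = (0::real)" "w 1 = 0"
  obtains z where "z \<in> {0..1}" "w' z = 0"
  using mvt01[OF d, of 0 1] that w by auto

text \<open>Landau's inequality: compare \<open>w' x\<close> with the difference quotient over a step \<open>h\<close> that
  stays inside \<open>[0,1]\<close>.\<close>

lemma Landau_bound:
  fixes w :: "real \<Rightarrow> real"
  assumes d: "\<And>x. x \<in> {0..1} \<Longrightarrow> (w has_real_derivative w' x) (at x within {0..1})"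
    and w: "\<And>x. x \<in> {0..1} \<Longrightarrow> \<bar>w x\<bar> \<le> \<eta>"
    and H: "\<And>s t. s \<in> {0..1} \<Longrightarrow> t \<in> {0..1} \<Longrightarrow> \<bar>w' s - w' t\<bar> \<le> H * \<bar>s - t\<bar> powr \<beta>"
    and "H \<ge> 0" "\<beta> > 0" and h: "0 < h" "h \<le> 1/2" and x: "x \<in> {0..1}"
  shows "\<bar>w' x\<bar> \<le> 2 * \<eta> / h + H * h powr \<beta>"
proof -
  define y where "y = (if x < 1/2 then x + h else x - h)"
  have y: "y \<in> {0..1}" "\<bar>y - x\<bar> = h" using x h by (auto simp: y_def)
  obtain z where z: "min x y \<le> z" "z \<le> max x y" "w y - w x = w' z * (y - x)"
    using mvt01[OF d x y(1)] by blast
  have z01: "z \<in> {0..1}" using z x y by (auto simp: min_def max_def split: if_splits)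
  have "\<bar>w' z\<bar> * h = \<bar>w y - w x\<bar>" using z(3) y(2) by (simp add: abs_mult)
  also have "\<dots> \<le> 2 * \<eta>" using w[OF x] w[OF y(1)] by linarith
  finally have 1: "\<bar>w' z\<bar> \<le> 2 * \<eta> / h" using h by (simp add: field_simps)
  have "\<bar>w' x - w' z\<bar> \<le> H * \<bar>x - z\<bar> powr \<beta>" using H x z01 by blast
  also have "\<dots> \<le> H * h powr \<beta>"
    using z y \<open>H \<ge> 0\<close> \<open>\<beta> > 0\<close> by (intro mult_left_mono powr_mono2) (auto simp: min_def max_def split: if_splits)
  finally show ?thesis using 1 by linarith
qed

section \<open>A priori bounds and stability of the forward map\<close>

lemma source_int_bounds:
  assumes f: "continuous_on {0..1} f" and b: "\<And>t. t \<in> {0..1} \<Longrightarrow> \<bar>f t\<bar> \<le> Fm"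
    and "s \<in> {0..1}" "t \<in> {0..1}"
  shows "\<bar>source_int f s - source_int f t\<bar> \<le> Fm * \<bar>s - t\<bar>"
  by (rule Lipschitz01_deriv[OF source_int_deriv[OF f] b]) (use assms in auto)

text \<open>The solution vanishes at both ends, so its derivative has a zero \<open>z\<close>, where
  the flux is zero. This bounds the constant independently of the coefficient and locates the
  critical point of the solution.\<close>

lemma flux_const_eq:
  assumes f: "continuous_on {0..1} f" and a: "continuous_on {0..1} a" "\<forall>t\<in>{0..1}. a t > 0"
  obtains z where "z \<in> {0..1}" "flux_const f a = source_int f z"
proof -
  obtain z where z: "z \<in> {0..1}" "(flux_const f a - source_int f z) / a z = 0"
    using Rolle01[OF forward_deriv[OF f a] forward_bdry[OF f a]] by blast
  moreover have "a z \<noteq> 0" using bspec[OF a(2) z(1)] by simp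
  ultimately show ?thesis using that by auto
qed

lemma flux_bound:
  assumes f: "continuous_on {0..1} f" and a: "continuous_on {0..1} a" "\<forall>t\<in>{0..1}. a t > 0"
    and b: "\<And>t. t \<in> {0..1} \<Longrightarrow> \<bar>f t\<bar> \<le> Fm" and x: "x \<in> {0..1}"
  shows "\<bar>flux_const f a - source_int f x\<bar> \<le> Fm"
proof -
  obtain z where z: "z \<in> {0..1}" "flux_const f a = source_int f z" by (rule flux_const_eq[OF f a])
  have "\<bar>source_int f z - source_int f x\<bar> \<le> Fm * \<bar>z - x\<bar>"
    by (rule source_int_bounds[OF f b z(1) x])
  also have "\<dots> \<le> Fm * 1" using b[OF x] z x by (intro mult_left_mono) auto
  finally show ?thesis using z by simp
qed

text \<open>The constant depends only on the bounds for \<open>f\<close> and on the lower bound for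
  \<open>a\<close>, so almost all coefficients under the prior share one Lipschitz constant for
  their solutions.\<close>

lemma forward_deriv_bound:
  assumes f: "continuous_on {0..1} f" and a: "continuous_on {0..1} a" 
    and a0: "a0 > 0" "\<forall>t\<in>{0..1}. a0 \<le> a t"
    and b: "\<And>t. t \<in> {0..1} \<Longrightarrow> \<bar>f t\<bar> \<le> Fm" and x: "x \<in> {0..1}"
  shows "\<bar>(flux_const f a - source_int f x) / a x\<bar> \<le> Fm / a0"
proof -
  have pos: "\<forall>t\<in>{0..1}. a t > 0" using a0 less_le_trans by blast
  have "\<bar>flux_const f a - source_int f x\<bar> / \<bar>a x\<bar> \<le> Fm / a0"
  proof (rule frac_le)
    show "0 \<le> Fm" using b[OF x] by linarith
    show "a0 \<le> \<bar>a x\<bar>" using bspec[OF a0(2) x] by linarith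
  qed (use flux_bound[OF f a pos b x] a0(1) in auto)
  then show ?thesis by (simp add: abs_divide)
qed

text \<open>The fluxes \<open>a p'\<close> of two solutions differ by a constant, which Rolle's theorem evaluates at a
  point where the derivatives of the solutions agree.\<close>

lemma forward_stable:
  assumes f: "continuous_on {0..1} f" and a: "continuous_on {0..1} a" and c: "continuous_on {0..1} c"
    and a0: "a0 > 0" "\<forall>t\<in>{0..1}. a0 \<le> a t" "\<forall>t\<in>{0..1}. a0 \<le> c t"
    and b: "\<And>t. t \<in> {0..1} \<Longrightarrow> \<bar>f t\<bar> \<le> Fm"
    and \<rho>: "\<And>t. t \<in> {0..1} \<Longrightarrow> \<bar>a t - c t\<bar> \<le> \<rho>"
    and x: "x \<in> {0..1}"
  shows "\<bar>forward f a x - forward f c x\<bar> \<le> 2 * \<rho> * Fm / a0\<^sup>2"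
proof -
  have pos: "\<forall>t\<in>{0..1}. a t > 0" "\<forall>t\<in>{0..1}. c t > 0" using a0 less_le_trans by blast+
  define p' where "p' t = (flux_const f a - source_int f t) / a t" for t
  define q' where "q' t = (flux_const f c - source_int f t) / c t" for t
  define d where "d = flux_const f a - flux_const f c"
  have dif: "((\<lambda>t. forward f a t - forward f c t) has_real_derivative p' t - q' t) (at t within {0..1})"
    if "t \<in> {0..1}" for t unfolding p'_def q'_def
    by (intro DERIV_diff forward_deriv f a c pos that)
  \<comment> \<open>Subtracting the two identities for the fluxes \<open>a p'\<close> and
    \<open>c q'\<close> eliminates the primitive of \<open>f\<close>.\<close>
  have d_eq: "a t * (p' t - q' t) = d - (a t - c t) * q' t" if "t \<in> {0..1}" for t
  proof -
    have "a t \<noteq> 0" "c t \<noteq> 0" using bspec[OF pos(1) that] bspec[OF pos(2) that] by auto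
    then have "a t * p' t = flux_const f a - source_int f t" "c t * q' t = flux_const f c - source_int f t"
      by (auto simp: p'_def q'_def)
    then show ?thesis by (simp add: d_def algebra_simps)
  qed
  have uq: "\<bar>(a t - c t) * q' t\<bar> \<le> \<rho> * (Fm / a0)" if "t \<in> {0..1}" for t
    unfolding abs_mult q'_def
    using \<rho>[OF that] forward_deriv_bound[OF f c a0(1,3) b that] by (intro mult_mono) auto
  obtain z where z: "z \<in> {0..1}" "p' z - q' z = 0"
    by (rule Rolle01[OF dif]) (auto simp: forward_bdry f a c pos)
  have "\<bar>d\<bar> \<le> \<rho> * (Fm / a0)" using d_eq[OF z(1)] uq[OF z(1)] z(2) by simp
  then have "\<bar>p' t - q' t\<bar> \<le> 2 * \<rho> * Fm / a0\<^sup>2" if "t \<in> {0..1}" for t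
  proof -
    have "a0 * \<bar>p' t - q' t\<bar> \<le> \<bar>a t * (p' t - q' t)\<bar>"
      unfolding abs_mult using bspec[OF a0(2) that] by (intro mult_right_mono) auto
    also have "\<dots> \<le> 2 * (\<rho> * (Fm / a0))"
      using d_eq[OF that] uq[OF that] \<open>\<bar>d\<bar> \<le> _\<close> by linarith
    finally show ?thesis using a0(1) by (simp add: field_simps power2_eq_square)
  qed
  \<comment> \<open>The difference of the solutions vanishes at 0, so the bound on its derivative
    bounds its value at \<open>x\<close>.\<close>
  from Lipschitz01_deriv[OF dif this x, of 0] have 
    "\<bar>forward f a x - forward f c x\<bar> \<le> 2 * \<rho> * Fm / a0\<^sup>2 * \<bar>x\<bar>"
    by (simp add: forward_bdry f a c pos)
  also have "\<dots> \<le> 2 * \<rho> * Fm / a0\<^sup>2 * 1"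
    using x \<rho>[OF x] b[OF x] a0(1) by (intro mult_left_mono) auto
  finally show ?thesis by simp
qed

section \<open>Stability of the inverse problem\<close>

text \<open>Dividing by \<open>H + 1\<close> covers \<open>H = 0\<close>. The cap 1/2 makes
  \<open>h\<close> an admissible step in \<open>Landau_bound\<close>.\<close>

lemma small_powr:
  fixes \<beta> e H :: real
  assumes "\<beta> > 0" "e > 0" "H \<ge> 0"
  obtains h where "0 < h" "h \<le> 1/2" "H * h powr \<beta> \<le> e"
proof -
  define h where "h = min (1/2) ((e / (H + 1)) powr (1 / \<beta>))"
  have h: "0 < h" "h \<le> 1/2" using assms by (auto simp: h_def)
  have "h powr \<beta> \<le> ((e / (H + 1)) powr (1 / \<beta>)) powr \<beta>"
    using h assms by (intro powr_mono2) (auto simp: h_def)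
  also have "\<dots> = e / (H + 1)" using assms by (simp add: powr_powr)
  finally have "H * h powr \<beta> \<le> H * (e / (H + 1))" using assms by (intro mult_left_mono) auto
  also have "\<dots> \<le> e" using assms by (simp add: field_simps)
  finally show ?thesis using that h by blast
qed

text \<open>Writing \<open>p, q\<close> for the two solutions, Landau's inequality makes
  \<open>p' - q'\<close> small.  The constant \<open>d = a p' - c q'\<close> is then small because \<open>q'\<close> has a zero \<open>z\<close>, and
  \<open>(a - c) q' = d - a (p' - q')\<close> with \<open>\<bar>q' x\<bar> \<ge> f_min \<bar>x - z\<bar> / L\<close> controls \<open>a - c\<close> away from \<open>z\<close>.  Near \<open>z\<close>
  the Lipschitz bound takes over.\<close>

lemma coefficient_stable:
  assumes f: "continuous_on {0..1} f" and Fm: "\<And>t. t \<in> {0..1} \<Longrightarrow> \<bar>f t\<bar> \<le> Fm"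
    and f_min: "f_min > 0" "\<And>t. t \<in> {0..1} \<Longrightarrow> f t \<ge> f_min"
    and a0: "a0 > 0" and L: "L > 0" and e: "e > 0"
  obtains \<kappa> where "\<kappa> > 0"
    "\<And>a c x. \<lbrakk>\<forall>t\<in>{0..1}. a0 \<le> a t \<and> a t \<le> L; \<forall>t\<in>{0..1}. a0 \<le> c t \<and> c t \<le> L;
       \<forall>s\<in>{0..1}. \<forall>t\<in>{0..1}. \<bar>a s - a t\<bar> \<le> L * \<bar>s - t\<bar>;
       \<forall>s\<in>{0..1}. \<forall>t\<in>{0..1}. \<bar>c s - c t\<bar> \<le> L * \<bar>s - t\<bar>;
       \<forall>t\<in>{0..1}. \<bar>forward f a t - forward f c t\<bar> \<le> \<kappa>; x \<in> {0..1}\<rbrakk> \<Longrightarrow> \<bar>a x - c x\<bar> \<le> e"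
proof -
  have Fm0: "Fm \<ge> 0" using Fm[of 0] by simp
  \<comment> \<open>Radius of the neighbourhood of \<open>z\<close> that is bridged by the Lipschitz
    bounds: moving by \<open>2 * r\<close> changes \<open>a\<close> and \<open>c\<close> together by
    at most \<open>4 * L * r\<close>, half of \<open>e\<close>.\<close>
  define r where "r = min (1/2) (e / (8 * L))"
  have r: "r > 0" "r \<le> 1/2" "4 * L * r \<le> e / 2"
    using e L by (auto simp: r_def min_def field_simps)
  \<comment> \<open>Target accuracy for \<open>p' - q'\<close>, chosen so that the bound
    \<open>2 * L\<^sup>2 * \<delta> / f_min\<close> on
    \<open>\<bar>a y - c y\<bar> * \<bar>y - z\<bar>\<close> becomes
    \<open>e / 2 * r\<close>.\<close>
  define \<delta> where "\<delta> = e * f_min * r / (4 * L\<^sup>2)"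
  have \<delta>: "\<delta> > 0" using e f_min r L by (simp add: \<delta>_def)
  \<comment> \<open>Lipschitz constant of \<open>p'\<close> and of \<open>q'\<close>, one summand
    for the numerator of the quotient and one for its denominator. The difference
    \<open>p' - q'\<close> has constant \<open>2 * H\<close>.\<close>
  define H where "H = Fm / a0 + Fm * L / a0\<^sup>2"
  have H: "H \<ge> 0" using Fm0 a0 L by (simp add: H_def)
  obtain h where h: "0 < h" "h \<le> 1/2" "2 * H * h powr 1 \<le> \<delta> / 2"
    using small_powr[of 1 "\<delta>/2" "2 * H"] \<delta> H by auto
  \<comment> \<open>Makes the first term \<open>2 * \<kappa> / h\<close> of Landau's inequality
    equal to half of \<open>\<delta>\<close>.\<close>
  define \<kappa> where "\<kappa> = \<delta> * h / 4"
  have \<kappa>: "\<kappa> > 0" using \<delta> h by (simp add: \<kappa>_def)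
  show thesis
  proof (rule that[OF \<kappa>])
    fix a c x
    assume ab: "\<forall>t\<in>{0..1}. a0 \<le> a t \<and> a t \<le> L" and cb: "\<forall>t\<in>{0..1}. a0 \<le> c t \<and> c t \<le> L"
      and aL: "\<forall>s\<in>{0..1}. \<forall>t\<in>{0..1}. \<bar>a s - a t\<bar> \<le> L * \<bar>s - t\<bar>"
      and cL: "\<forall>s\<in>{0..1}. \<forall>t\<in>{0..1}. \<bar>c s - c t\<bar> \<le> L * \<bar>s - t\<bar>"
      and close: "\<forall>t\<in>{0..1}. \<bar>forward f a t - forward f c t\<bar> \<le> \<kappa>" and x: "x \<in> {0..1::real}"
    have cont: "continuous_on {0..1} b" if "\<forall>s\<in>{0..1}. \<forall>t\<in>{0..1}. \<bar>b s - b t\<bar> \<le> L * \<bar>s - t\<bar>" for b :: "real \<Rightarrow> real"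
      by (rule lipschitz_on_continuous_on[of L]) (use that L in \<open>auto simp: lipschitz_on_def dist_real_def\<close>)
    note ac = cont[OF aL] and cc = cont[OF cL]
    have ap: "\<forall>t\<in>{0..1}. a t > 0" and cp: "\<forall>t\<in>{0..1}. c t > 0"
      using ab cb a0 less_le_trans by blast+
    define p' where "p' t = (flux_const f a - source_int f t) / a t" for t
    define q' where "q' t = (flux_const f c - source_int f t) / c t" for t
    define d where "d = flux_const f a - flux_const f c"
    have dif: "((\<lambda>t. forward f a t - forward f c t) has_real_derivative p' t - q' t) (at t within {0..1})"
      if "t \<in> {0..1}" for t unfolding p'_def q'_def
      by (intro DERIV_diff forward_deriv f ac cc ap cp that)
    have Lip: "\<bar>(flux_const f b - source_int f s) / b s - (flux_const f b - source_int f t) / b t\<bar> \<le> H * \<bar>s - t\<bar>"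
      if bb: "\<forall>t\<in>{0..1}. a0 \<le> b t \<and> b t \<le> L" and bL: "\<forall>s\<in>{0..1}. \<forall>t\<in>{0..1}. \<bar>b s - b t\<bar> \<le> L * \<bar>s - t\<bar>"
        and st: "s \<in> {0..1}" "t \<in> {0..1}" for b :: "real \<Rightarrow> real" and s t
    proof -
      have bp: "\<forall>t\<in>{0..1}. b t > 0" using bb a0 less_le_trans by blast
      have bs: "b s \<ge> a0" "b t \<ge> a0" using bb st by auto
      define G where "G t = flux_const f b - source_int f t" for t
      have G: "\<bar>G t\<bar> \<le> Fm" unfolding G_def by (rule flux_bound[OF f cont[OF bL] bp Fm st(2)])
      have GL: "\<bar>G s - G t\<bar> \<le> Fm * \<bar>s - t\<bar>"
        using source_int_bounds[OF f Fm st] by (simp add: G_def)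
      have "G s / b s - G t / b t = (G s - G t) / b s + G t * (b t - b s) / (b s * b t)"
        using bs a0 by (simp add: field_simps)
      also have "\<bar>\<dots>\<bar> \<le> \<bar>G s - G t\<bar> / b s + \<bar>G t\<bar> * \<bar>b t - b s\<bar> / (b s * b t)"
        using bs a0 by (intro order.trans[OF abs_triangle_ineq]) (simp add: abs_mult)
      also have "\<dots> \<le> Fm * \<bar>s - t\<bar> / a0 + Fm * (L * \<bar>s - t\<bar>) / (a0 * a0)"
        using bs a0 G GL bL st Fm0 L
        by (intro add_mono frac_le mult_mono) (auto simp: abs_minus_commute)
      also have "\<dots> = H * \<bar>s - t\<bar>" by (simp add: H_def power2_eq_square algebra_simps add_divide_distrib)
      finally show ?thesis unfolding G_def .
    qed
    have Lip': "\<bar>(p' s - q' s) - (p' t - q' t)\<bar> \<le> (2 * H) * \<bar>s - t\<bar> powr 1"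
      if "s \<in> {0..1}" "t \<in> {0..1}" for s t
      using Lip[OF ab aL that] Lip[OF cb cL that] unfolding p'_def q'_def by simp
    have D: "\<bar>p' t - q' t\<bar> \<le> \<delta>" if "t \<in> {0..1}" for t
    proof -
      have "\<bar>p' t - q' t\<bar> \<le> 2 * \<kappa> / h + 2 * H * h powr 1"
        by (rule Landau_bound[OF dif _ Lip' _ _ h(1,2) that]) (use close H in auto)
      also have "2 * \<kappa> / h = \<delta> / 2" using h by (simp add: \<kappa>_def)
      finally show ?thesis using h(3) by linarith
    qed
    have d_eq: "a t * (p' t - q' t) = d - (a t - c t) * q' t" if "t \<in> {0..1}" for t
    proof -
      have "a t \<noteq> 0" "c t \<noteq> 0" using bspec[OF ap that] bspec[OF cp that] by auto
      then have "a t * p' t = flux_const f a - source_int f t" "c t * q' t = flux_const f c - source_int f t"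
        by (auto simp: p'_def q'_def)
      then show ?thesis by (simp add: d_def algebra_simps)
    qed
    have aD: "\<bar>a t * (p' t - q' t)\<bar> \<le> L * \<delta>" if "t \<in> {0..1}" for t
      unfolding abs_mult using D[OF that] ab ap that L by (intro mult_mono) (auto simp: less_imp_le)
    obtain z where z: "z \<in> {0..1}" "flux_const f c = source_int f z" by (rule flux_const_eq[OF f cc cp])
    have "q' z = 0" using z by (simp add: q'_def)
    then have d: "\<bar>d\<bar> \<le> L * \<delta>" using d_eq[OF z(1)] aD[OF z(1)] by simp
    have away: "\<bar>a y - c y\<bar> * \<bar>y - z\<bar> \<le> 2 * L\<^sup>2 * \<delta> / f_min" if y: "y \<in> {0..1}" for y
    proof -
      \<comment> \<open>The primitive of \<open>f\<close> has slope at least \<open>f_min\<close>,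
        so \<open>c q'\<close> grows at least linearly away from its zero \<open>z\<close>.\<close>
      obtain w where w: "min z y \<le> w" "w \<le> max z y" "source_int f y - source_int f z = f w * (y - z)"
        using mvt01[OF source_int_deriv[OF f] z(1) y] by blast
      have "w \<in> {0..1}" using w z(1) y by (auto simp: min_def max_def split: if_splits)
      then have "f_min * \<bar>y - z\<bar> \<le> \<bar>source_int f y - source_int f z\<bar>"
        unfolding w(3) abs_mult using f_min by (intro mult_right_mono) (auto intro: order.trans[OF _ abs_ge_self])
      also have "\<dots> = c y * \<bar>q' y\<bar>"
        using bspec[OF cp y] z(2) by (simp add: q'_def abs_divide abs_minus_commute)
      also have "\<dots> \<le> L * \<bar>q' y\<bar>" using cb y by (intro mult_right_mono) auto
      finally have "\<bar>a y - c y\<bar> * (f_min * \<bar>y - z\<bar>) \<le> \<bar>a y - c y\<bar> * (L * \<bar>q' y\<bar>)"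
        by (intro mult_left_mono) auto
      also have "\<dots> = L * \<bar>(a y - c y) * q' y\<bar>" by (simp add: abs_mult)
      also have "\<dots> \<le> L * (2 * (L * \<delta>))"
        using d_eq[OF y] aD[OF y] d L by (intro mult_left_mono) auto
      finally show ?thesis using f_min by (simp add: field_simps power2_eq_square)
    qed
    \<comment> \<open>If \<open>x\<close> is too close to \<open>z\<close>, replace it by the point
      at distance \<open>r\<close> from \<open>z\<close> towards the farther end. It is within
      \<open>2 * r\<close> of \<open>x\<close>.\<close>
    obtain y where y: "y \<in> {0..1}" "\<bar>y - x\<bar> \<le> 2 * r" "\<bar>y - z\<bar> \<ge> r"
    proof (cases "\<bar>x - z\<bar> \<ge> r")
      case True
      then show ?thesis using that[of x] x r by auto
    next
      case False
      define y where "y = (if z < 1/2 then z + r else z - r)"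
      show ?thesis by (rule that[of y]) (use z(1) r False in \<open>auto simp: y_def\<close>)
    qed
    have "\<bar>a y - c y\<bar> * r \<le> \<bar>a y - c y\<bar> * \<bar>y - z\<bar>" using y by (intro mult_left_mono) auto
    also have "\<dots> \<le> 2 * L\<^sup>2 * \<delta> / f_min" by (rule away[OF y(1)])
    also have "\<dots> = e / 2 * r" using L f_min by (simp add: \<delta>_def field_simps)
    finally have "\<bar>a y - c y\<bar> \<le> e / 2" using r by simp
    moreover have "\<bar>a y - a x\<bar> \<le> L * (2 * r)" "\<bar>c y - c x\<bar> \<le> L * (2 * r)"
      using aL cL x y L by (meson less_imp_le mult_left_mono order.trans)+
    ultimately show "\<bar>a x - c x\<bar> \<le> e" using r(3) by argo
  qed
qed

section \<open>Interpolation between uniform and Hoelder bounds\<close>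

definition holder_bounded :: "real \<Rightarrow> real \<Rightarrow> (real \<Rightarrow> real) \<Rightarrow> bool" where
  "holder_bounded \<gamma> H g \<longleftrightarrow>
     Ck01 (nat \<lfloor>\<gamma>\<rfloor>) g \<and> (\<forall>j\<le>nat \<lfloor>\<gamma>\<rfloor>. \<forall>x\<in>{0..1}. \<bar>D01 j g x\<bar> \<le> H) \<and>
     (frac \<gamma> \<noteq> 0 \<longrightarrow> (\<forall>s\<in>{0..1}. \<forall>t\<in>{0..1}.
        \<bar>D01 (nat \<lfloor>\<gamma>\<rfloor>) g s - D01 (nat \<lfloor>\<gamma>\<rfloor>) g t\<bar> \<le> H * \<bar>s - t\<bar> powr frac \<gamma>))"

text \<open>Passes to real inequalities by bounding each summand of the norm by the whole.
  Multiplying out the difference quotient includes the case \<open>s = t\<close>.\<close>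

lemma holder_norm_le_imp_bounded:
  assumes n: "holder_norm \<gamma> g \<le> ennreal H" and H: "H \<ge> 0"
  shows "holder_bounded \<gamma> H g"
proof -
  define k where "k = nat \<lfloor>\<gamma>\<rfloor>"
  define A where "A = (\<Sum>j\<le>k. SUP x\<in>{0..1}. ennreal \<bar>D01 j g x\<bar>)"
  define B where "B = (SUP (s, t)\<in>{(s, t). s \<in> {0..1} \<and> t \<in> {0..1} \<and> s \<noteq> t}.
                ennreal (\<bar>D01 k g s - D01 k g t\<bar> / \<bar>s - t\<bar> powr frac \<gamma>))"
  have C: "Ck01 k g"
    using n unfolding holder_norm_def Let_def k_def
    by (auto split: if_splits simp: top_unique infinity_ennreal_def)
  have eq: "holder_norm \<gamma> g = A + (if frac \<gamma> = 0 then 0 else B)"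
    unfolding holder_norm_def Let_def A_def B_def using C by (simp add: k_def)
  have A: "A \<le> ennreal H" using n unfolding eq by (metis add_increasing2 le_iff_add order.trans)
  have B: "B \<le> ennreal H" if "frac \<gamma> \<noteq> 0" 
    using n that unfolding eq by (metis (full_types) add.commute le_iff_add order.trans)
  have "\<bar>D01 j g x\<bar> \<le> H" if "j \<le> k" "x \<in> {0..1}" for j x
  proof -
    have "ennreal \<bar>D01 j g x\<bar> \<le> (SUP x\<in>{0..1}. ennreal \<bar>D01 j g x\<bar>)" by (rule SUP_upper[OF that(2)])
    also have "\<dots> \<le> A" unfolding A_def
      by (rule member_le_sum[where f = "\<lambda>j. SUP x\<in>{0..1}. ennreal \<bar>D01 j g x\<bar>"]) (use that in auto)
    finally show ?thesis using A H by (metis ennreal_le_iff order.trans)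
  qed
  moreover have "\<bar>D01 k g s - D01 k g t\<bar> \<le> H * \<bar>s - t\<bar> powr frac \<gamma>"
    if "frac \<gamma> \<noteq> 0" "s \<in> {0..1}" "t \<in> {0..1}" for s t
  proof (cases "s = t")
    case False
    have "ennreal (\<bar>D01 k g s - D01 k g t\<bar> / \<bar>s - t\<bar> powr frac \<gamma>) \<le> B"
      unfolding B_def by (rule SUP_upper2[of "(s, t)"]) (use that False in auto)
    then have "\<bar>D01 k g s - D01 k g t\<bar> / \<bar>s - t\<bar> powr frac \<gamma> \<le> H"
      using B[OF that(1)] H by (metis ennreal_le_iff order.trans)
    then show ?thesis using False by (simp add: field_simps)
  qed (use H in auto)
  ultimately show ?thesis using C unfolding holder_bounded_def k_def by blast
qed

lemma holder_bounded_diff: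
  assumes g: "holder_bounded \<gamma> H g" and h: "holder_bounded \<gamma> H h"
  shows "holder_bounded \<gamma> (2 * H) (\<lambda>t. g t - h t)"
proof -
  let ?k = "nat \<lfloor>\<gamma>\<rfloor>"
  have C: "Ck01 ?k g" "Ck01 ?k h" using g h by (auto simp: holder_bounded_def)
  note D = D01_diff[OF C]
  have "\<bar>D01 j (\<lambda>t. g t - h t) x\<bar> \<le> 2 * H" if "j \<le> ?k" "x \<in> {0..1}" for j x
  proof -
    have "\<bar>D01 j g x\<bar> \<le> H" "\<bar>D01 j h x\<bar> \<le> H" using g h that unfolding holder_bounded_def by blast+
    then show ?thesis unfolding D[OF that] by linarith
  qed
  moreover have "\<bar>D01 ?k (\<lambda>t. g t - h t) s - D01 ?k (\<lambda>t. g t - h t) t\<bar> \<le> 2 * H * \<bar>s - t\<bar> powr frac \<gamma>"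
    if "frac \<gamma> \<noteq> 0" "s \<in> {0..1}" "t \<in> {0..1}" for s t
  proof -
    have "\<bar>D01 ?k g s - D01 ?k g t\<bar> \<le> H * \<bar>s - t\<bar> powr frac \<gamma>"
      "\<bar>D01 ?k h s - D01 ?k h t\<bar> \<le> H * \<bar>s - t\<bar> powr frac \<gamma>"
      using g h that unfolding holder_bounded_def by blast+
    then show ?thesis unfolding D[OF order.refl that(2)] D[OF order.refl that(3)] by linarith
  qed
  ultimately show ?thesis using Ck01_diff[OF C] unfolding holder_bounded_def by blast
qed

text \<open>Below the top order the next derivative is bounded, giving a Lipschitz bound; at the top
  order the Hoelder seminorm gives the modulus. For integer \<open>\<gamma>\<close> the top
  derivative carries no such bound, hence the condition on \<open>j\<close>.\<close>

lemma holder_bounded_modulus: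
  assumes u: "holder_bounded \<gamma> H u" and j: "j < nat \<lfloor>\<gamma>\<rfloor> \<or> j = nat \<lfloor>\<gamma>\<rfloor> \<and> frac \<gamma> \<noteq> 0"
    and st: "s \<in> {0..1}" "t \<in> {0..1}"
  shows "\<bar>D01 j u s - D01 j u t\<bar> \<le> H * \<bar>s - t\<bar> powr (if j < nat \<lfloor>\<gamma>\<rfloor> then 1 else frac \<gamma>)"
proof (cases "j < nat \<lfloor>\<gamma>\<rfloor>")
  case True
  have C: "Ck01 (nat \<lfloor>\<gamma>\<rfloor>) u" using u by (simp add: holder_bounded_def)
  have "\<bar>D01 j u s - D01 j u t\<bar> \<le> H * \<bar>s - t\<bar>"
    by (rule Lipschitz01_deriv[OF Ck01_has_derivative[OF C True] _ st])
      (use u True in \<open>unfold holder_bounded_def, auto simp del: D01.simps\<close>)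
  then show ?thesis using True by simp
next
  case False
  then show ?thesis using assms unfolding holder_bounded_def by auto
qed

text \<open>Induction on the order by Landau's inequality: a small derivative of order
  \<open>j\<close> and a modulus for order \<open>Suc j\<close> make the latter small. The choice of
  the bound on \<open>u\<close> is uniform in \<open>u\<close>.\<close>

lemma D01_small:
  assumes H: "H \<ge> 0" and j: "j < nat \<lfloor>\<gamma>\<rfloor> \<or> j = nat \<lfloor>\<gamma>\<rfloor> \<and> frac \<gamma> \<noteq> 0" and e: "e > 0"
  shows "\<exists>\<delta>>0. \<forall>u. holder_bounded \<gamma> H u \<longrightarrow> (\<forall>x\<in>{0..1}. \<bar>u x\<bar> \<le> \<delta>) \<longrightarrow> (\<forall>x\<in>{0..1}. \<bar>D01 j u x\<bar> \<le> e)"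
  using j e
proof (induction j arbitrary: e)
  case 0
  then show ?case by auto
next
  case (Suc j)
  let ?k = "nat \<lfloor>\<gamma>\<rfloor>"
  define \<beta> where "\<beta> = (if Suc j < ?k then 1 else frac \<gamma>)"
  have \<beta>: "\<beta> > 0" using Suc.prems(1) by (auto simp: \<beta>_def less_le)
  obtain h where h: "0 < h" "h \<le> 1/2" "H * h powr \<beta> \<le> e / 2"
    using small_powr[of \<beta> "e/2" H] \<beta> H Suc.prems by auto
  \<comment> \<open>Landau's inequality multiplies this bound by \<open>2 / h\<close>, giving
    \<open>e / 2\<close>.\<close>
  have "e * h / 4 > 0" using Suc.prems h by simp
  then obtain \<delta> where \<delta>: "\<delta> > 0" "\<And>u x. holder_bounded \<gamma> H u \<Longrightarrow> (\<forall>x\<in>{0..1}. \<bar>u x\<bar> \<le> \<delta>) \<Longrightarrow> x \<in> {0..1} \<Longrightarrow> 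
      \<bar>D01 j u x\<bar> \<le> e * h / 4"
    using Suc.IH[of "e * h / 4"] Suc.prems(1) by auto
  have "\<bar>D01 (Suc j) u x\<bar> \<le> e" if u: "holder_bounded \<gamma> H u" "\<forall>x\<in>{0..1}. \<bar>u x\<bar> \<le> \<delta>" and x: "x \<in> {0..1}" for u x
  proof -
    have C: "Ck01 ?k u" using u by (simp add: holder_bounded_def)
    have "\<bar>D01 (Suc j) u x\<bar> \<le> 2 * (e * h / 4) / h + H * h powr \<beta>"
    proof (rule Landau_bound[OF _ _ _ H \<beta> h(1,2) x])
      show "(D01 j u has_real_derivative D01 (Suc j) u t) (at t within {0..1})" if "t \<in> {0..1}" for t
        by (rule Ck01_has_derivative[OF C _ that]) (use Suc.prems in auto)
      show "\<bar>D01 j u t\<bar> \<le> e * h / 4" if "t \<in> {0..1}" for t by (rule \<delta>(2)[OF u that])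
      show "\<bar>D01 (Suc j) u s - D01 (Suc j) u t\<bar> \<le> H * \<bar>s - t\<bar> powr \<beta>" if "s \<in> {0..1}" "t \<in> {0..1}" for s t
        unfolding \<beta>_def by (rule holder_bounded_modulus[OF u(1) Suc.prems(1) that])
    qed
    also have "2 * (e * h / 4) / h = e / 2" using h by simp
    finally show ?thesis using h(3) by linarith
  qed
  then show ?case using \<delta>(1) by blast
qed

text \<open>All derivatives up to order \<open>k'\<close> are small by \<open>D01_small\<close>. In
  the seminorm, close points gain from the larger exponent \<open>\<beta>\<close> of the modulus,
  while for separated points the uniform bound suffices.\<close>

lemma holder_norm_small:
  assumes \<gamma>: "0 \<le> \<gamma>'" "\<gamma>' < \<gamma>" and H: "H \<ge> 0" and e: "\<epsilon> > 0"
  obtains \<delta> where "\<delta> > 0" "\<And>u. \<lbrakk>holder_bounded \<gamma> H u; \<forall>x\<in>{0..1}. \<bar>u x\<bar> \<le> \<delta>\<rbrakk> \<Longrightarrow> holder_norm \<gamma>' u < ennreal \<epsilon>"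
proof -
  define k where "k = nat \<lfloor>\<gamma>\<rfloor>"
  define k' where "k' = nat \<lfloor>\<gamma>'\<rfloor>"
  define \<beta> where "\<beta> = (if k' < k then 1 else frac \<gamma>)"
  have k': "k' < k \<or> k' = k \<and> frac \<gamma>' < frac \<gamma>"
  proof -
    have "\<lfloor>\<gamma>'\<rfloor> \<le> \<lfloor>\<gamma>\<rfloor>" using \<gamma> by (intro floor_mono) auto
    moreover have "frac \<gamma>' < frac \<gamma>" if "\<lfloor>\<gamma>'\<rfloor> = \<lfloor>\<gamma>\<rfloor>" using that \<gamma> by (simp add: frac_def)
    moreover have "\<lfloor>\<gamma>'\<rfloor> \<ge> 0" using \<gamma> by simp
    ultimately show ?thesis unfolding k_def k'_def by linarith
  qed
  have \<beta>: "\<beta> > frac \<gamma>'" using k' frac_lt_1[of \<gamma>'] by (auto simp: \<beta>_def)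
  have k'_le: "j < k \<or> j = k \<and> frac \<gamma> \<noteq> 0" if "j \<le> k'" for j
  proof -
    have "frac \<gamma> \<noteq> 0" if "frac \<gamma>' < frac \<gamma>" using that frac_ge_0[of \<gamma>'] by linarith
    then show ?thesis using k' that by linarith
  qed
  obtain h where h: "0 < h" "h \<le> 1/2" "H * h powr (\<beta> - frac \<gamma>') \<le> \<epsilon> / 4"
    using small_powr[of "\<beta> - frac \<gamma>'" "\<epsilon>/4" H] \<beta> H e by auto
  \<comment> \<open>The first bound makes the \<open>k' + 1\<close> suprema add up to at most a
    quarter of the target; the second does the same for the quotients at points farther apart than
    \<open>h\<close>.\<close>
  define e1 where "e1 = min (\<epsilon> / (4 * (real k' + 1))) (\<epsilon> / 8 * h powr frac \<gamma>')"
  have e1: "e1 > 0" "(real k' + 1) * e1 \<le> \<epsilon> / 4" "2 * e1 / h powr frac \<gamma>' \<le> \<epsilon> / 4"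
  proof -
    show "e1 > 0" using e h by (simp add: e1_def)
    have "e1 \<le> \<epsilon> / (4 * (real k' + 1))" by (simp add: e1_def)
    then have "(real k' + 1) * e1 \<le> (real k' + 1) * (\<epsilon> / (4 * (real k' + 1)))" by (intro mult_left_mono) auto
    also have "\<dots> = \<epsilon> / 4" by (simp add: field_simps)
    finally show "(real k' + 1) * e1 \<le> \<epsilon> / 4" .
    have "e1 \<le> \<epsilon> / 8 * h powr frac \<gamma>'" unfolding e1_def by (rule min.cobounded2)
    then show "2 * e1 / h powr frac \<gamma>' \<le> \<epsilon> / 4" using h by (simp add: field_simps)
  qed
  define Q where "Q j d \<longleftrightarrow> (\<forall>u. holder_bounded \<gamma> H u \<longrightarrow> (\<forall>x\<in>{0..1}. \<bar>u x\<bar> \<le> d) \<longrightarrow> (\<forall>x\<in>{0..1}. \<bar>D01 j u x\<bar> \<le> e1))"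
    for j d
  have "\<exists>d>0. Q j d" if "j \<le> k'" for j
    unfolding Q_def by (rule D01_small[OF H _ e1(1)]) (use k'_le[OF that] in \<open>simp add: k_def\<close>)
  then obtain \<delta> where "\<And>j. j \<le> k' \<Longrightarrow> \<delta> j > 0 \<and> Q j (\<delta> j)" by metis
  then have \<delta>: "\<And>j. j \<le> k' \<Longrightarrow> \<delta> j > 0" 
    "\<And>j u x. j \<le> k' \<Longrightarrow> holder_bounded \<gamma> H u \<Longrightarrow> \<forall>x\<in>{0..1}. \<bar>u x\<bar> \<le> \<delta> j \<Longrightarrow> x \<in> {0..1} \<Longrightarrow> \<bar>D01 j u x\<bar> \<le> e1"
    unfolding Q_def by blast+
  define \<delta>0 where "\<delta>0 = Min (\<delta> ` {..k'})"
  have \<delta>0: "\<delta>0 > 0" "\<And>j. j \<le> k' \<Longrightarrow> \<delta>0 \<le> \<delta> j" using \<delta>(1) by (auto simp: \<delta>0_def)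
  show thesis
  proof (rule that[OF \<delta>0(1)])
    fix u assume u: "holder_bounded \<gamma> H u" and small: "\<forall>x\<in>{0..1}. \<bar>u x\<bar> \<le> \<delta>0"
    have C: "Ck01 k' u" using u Ck01_mono[of k u k'] k' by (auto simp: holder_bounded_def k_def)
    have D: "\<bar>D01 j u x\<bar> \<le> e1" if "j \<le> k'" "x \<in> {0..1}" for j x
      by (rule \<delta>(2)[OF that(1) u _ that(2)]) (use small \<delta>0(2)[OF that(1)] in force)
    have "(\<Sum>j\<le>k'. SUP x\<in>{0..1}. ennreal \<bar>D01 j u x\<bar>) \<le> (\<Sum>j\<le>k'. ennreal e1)"
      by (intro sum_mono SUP_least ennreal_leI D) auto
    also have "\<dots> = ennreal ((real k' + 1) * e1)"
      using e1 by (subst sum_ennreal) (auto simp: add.commute)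
    also have "\<dots> \<le> ennreal (\<epsilon> / 4)" by (intro ennreal_leI e1)
    finally have A: "(\<Sum>j\<le>k'. SUP x\<in>{0..1}. ennreal \<bar>D01 j u x\<bar>) \<le> ennreal (\<epsilon> / 4)" .
    have q: "\<bar>D01 k' u s - D01 k' u t\<bar> / \<bar>s - t\<bar> powr frac \<gamma>' \<le> \<epsilon> / 4"
      if st: "s \<in> {0..1}" "t \<in> {0..1}" "s \<noteq> t" for s t
    proof (cases "\<bar>s - t\<bar> \<le> h")
      case True
      have "\<bar>D01 k' u s - D01 k' u t\<bar> \<le> H * \<bar>s - t\<bar> powr \<beta>"
        using holder_bounded_modulus[OF u _ st(1,2), of k'] k'_le[of k'] unfolding \<beta>_def k_def by blast
      then have "\<bar>D01 k' u s - D01 k' u t\<bar> / \<bar>s - t\<bar> powr frac \<gamma>' \<le> H * \<bar>s - t\<bar> powr \<beta> / \<bar>s - t\<bar> powr frac \<gamma>'"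
        by (intro divide_right_mono) auto
      also have "\<dots> = H * \<bar>s - t\<bar> powr (\<beta> - frac \<gamma>')" by (simp add: powr_diff)
      also have "\<dots> \<le> H * h powr (\<beta> - frac \<gamma>')"
        using H True \<beta> by (intro mult_left_mono powr_mono2) auto
      finally show ?thesis using h(3) by linarith
    next
      case False
      have "\<bar>D01 k' u s - D01 k' u t\<bar> \<le> 2 * e1" using D[OF order.refl st(1)] D[OF order.refl st(2)] by linarith
      then have "\<bar>D01 k' u s - D01 k' u t\<bar> / \<bar>s - t\<bar> powr frac \<gamma>' \<le> 2 * e1 / h powr frac \<gamma>'"
        using False h e1(1) frac_ge_0[of \<gamma>'] by (intro frac_le powr_mono2) auto
      then show ?thesis using e1(3) by linarith
    qed
    have B: "(SUP (s, t)\<in>{(s, t). s \<in> {0..1} \<and> t \<in> {0..1} \<and> s \<noteq> t}.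
                ennreal (\<bar>D01 k' u s - D01 k' u t\<bar> / \<bar>s - t\<bar> powr frac \<gamma>')) \<le> ennreal (\<epsilon> / 4)"
      by (rule SUP_least) (use q in \<open>auto intro!: ennreal_leI\<close>)
    have "holder_norm \<gamma>' u \<le> ennreal (\<epsilon> / 4) + ennreal (\<epsilon> / 4)"
      unfolding holder_norm_def Let_def k'_def[symmetric] using C A B
      by (auto intro: add_mono add_increasing2)
    also have "\<dots> < ennreal \<epsilon>" using e by (simp flip: ennreal_plus add: ennreal_less_iff)
    finally show "holder_norm \<gamma>' u < ennreal \<epsilon>" .
  qed
qed

text \<open>An exponent above 1 puts a full derivative under the bound \<open>L\<close>, which makes
  the coefficients uniformly Lipschitz.\<close>

lemma holder_bounded_gt_1:
  assumes a: "holder_bounded \<gamma> L a" and \<gamma>: "\<gamma> > 1"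
  shows "\<forall>t\<in>{0..1}. a t \<le> L" "\<forall>s\<in>{0..1}. \<forall>t\<in>{0..1}. \<bar>a s - a t\<bar> \<le> L * \<bar>s - t\<bar>"
    "continuous_on {0..1} a"
proof -
  have k: "0 < nat \<lfloor>\<gamma>\<rfloor>" using \<gamma> by simp
  have C: "Ck01 (nat \<lfloor>\<gamma>\<rfloor>) a" using a by (simp add: holder_bounded_def)
  have "\<bar>D01 0 a t\<bar> \<le> L" if "t \<in> {0..1}" for t using a that unfolding holder_bounded_def by blast
  then show "\<forall>t\<in>{0..1}. a t \<le> L" by force
  show "\<forall>s\<in>{0..1}. \<forall>t\<in>{0..1}. \<bar>a s - a t\<bar> \<le> L * \<bar>s - t\<bar>"
    using holder_bounded_modulus[OF a, of 0] k by simp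
  show "continuous_on {0..1} a" using Ck01_continuous_on[OF C, of 0] by simp
qed

text \<open>The contrapositive chains two stability results: uniformly close solutions have
  uniformly close coefficients, and interpolation with the bound \<open>2 * L\<close> on their
  difference makes its weaker norm small.\<close>

lemma forward_identifies:
  assumes f: "continuous_on {0..1} f" and Fm: "\<And>t. t \<in> {0..1} \<Longrightarrow> \<bar>f t\<bar> \<le> Fm"
    and f_min: "f_min > 0" "\<And>t. t \<in> {0..1} \<Longrightarrow> f t \<ge> f_min"
    and a0: "a0 > 0" and L: "L > 0" and \<gamma>: "\<gamma> > 1" "0 \<le> \<gamma>'" "\<gamma>' < \<gamma>" and \<epsilon>: "\<epsilon> > 0"
    and c: "holder_bounded \<gamma> L c" "\<forall>t\<in>{0..1}. a0 \<le> c t"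
  obtains \<kappa> where "\<kappa> > 0"
    "\<And>a. \<lbrakk>holder_bounded \<gamma> L a; \<forall>t\<in>{0..1}. a0 \<le> a t; \<not> holder_norm \<gamma>' (\<lambda>t. a t - c t) < ennreal \<epsilon>\<rbrakk>
      \<Longrightarrow> \<exists>x\<in>{0..1}. \<bar>forward f a x - forward f c x\<bar> > \<kappa>"
proof -
  obtain \<delta> where \<delta>: "\<delta> > 0" "\<And>u. \<lbrakk>holder_bounded \<gamma> (2 * L) u; \<forall>x\<in>{0..1}. \<bar>u x\<bar> \<le> \<delta>\<rbrakk> \<Longrightarrow> holder_norm \<gamma>' u < ennreal \<epsilon>"
    using holder_norm_small[OF \<gamma>(2,3), of "2 * L" \<epsilon>] L \<epsilon> by auto
  obtain \<kappa> where \<kappa>: "\<kappa> > 0"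
    "\<And>a c x. \<lbrakk>\<forall>t\<in>{0..1}. a0 \<le> a t \<and> a t \<le> L; \<forall>t\<in>{0..1}. a0 \<le> c t \<and> c t \<le> L;
       \<forall>s\<in>{0..1}. \<forall>t\<in>{0..1}. \<bar>a s - a t\<bar> \<le> L * \<bar>s - t\<bar>;
       \<forall>s\<in>{0..1}. \<forall>t\<in>{0..1}. \<bar>c s - c t\<bar> \<le> L * \<bar>s - t\<bar>;
       \<forall>t\<in>{0..1}. \<bar>forward f a t - forward f c t\<bar> \<le> \<kappa>; x \<in> {0..1}\<rbrakk> \<Longrightarrow> \<bar>a x - c x\<bar> \<le> \<delta>"
    using Fm f_min(2) by (rule coefficient_stable[OF f _ f_min(1) _ a0 L \<delta>(1)]) (blast intro: that)+
  show thesis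
  proof (rule that[OF \<kappa>(1)], rule ccontr)
    fix a assume a: "holder_bounded \<gamma> L a" "\<forall>t\<in>{0..1}. a0 \<le> a t"
      and far: "\<not> holder_norm \<gamma>' (\<lambda>t. a t - c t) < ennreal \<epsilon>"
      and "\<not> (\<exists>x\<in>{0..1}. \<bar>forward f a x - forward f c x\<bar> > \<kappa>)"
    then have "\<forall>t\<in>{0..1}. \<bar>forward f a t - forward f c t\<bar> \<le> \<kappa>" by force
    then have "\<forall>x\<in>{0..1}. \<bar>a x - c x\<bar> \<le> \<delta>"
      using \<kappa>(2)[of a c] a c holder_bounded_gt_1[OF a(1) \<gamma>(1)] holder_bounded_gt_1[OF c(1) \<gamma>(1)] by simp
    then show False using \<delta>(2)[OF holder_bounded_diff[OF a(1) c(1)]] far by blast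
  qed
qed

section \<open>The noise and the design\<close>

lemma iid_gaussian_measurable:
  assumes "prob_space P" "iid_gaussian P \<sigma> \<xi>" "i \<ge> 1"
  shows "\<xi> i \<in> borel_measurable P"
  using assms distributed_measurable[of P lborel "\<xi> i"] by (auto simp: iid_gaussian_def)

text \<open>The sum is Gaussian with deviation \<open>\<sigma> * sqrt (card J)\<close>, and the
  first absolute moment of a centred Gaussian is \<open>sqrt (2 / pi)\<close>, at most 1, times its
  deviation.\<close>

lemma gaussian_sum_abs_bound:
  assumes P: "prob_space P" and \<sigma>: "\<sigma> > 0" and iid: "iid_gaussian P \<sigma> \<xi>"
    and J: "finite J" "J \<subseteq> {1..}"
  shows "integrable P (\<lambda>\<omega>. \<bar>\<Sum>i\<in>J. \<xi> i \<omega>\<bar>)" "(\<integral>\<omega>. \<bar>\<Sum>i\<in>J. \<xi> i \<omega>\<bar> \<partial>P) \<le> \<sigma> * sqrt (card J)"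
proof -
  interpret prob_space P by (rule P)
  have "integrable P (\<lambda>\<omega>. \<bar>\<Sum>i\<in>J. \<xi> i \<omega>\<bar>) \<and> (\<integral>\<omega>. \<bar>\<Sum>i\<in>J. \<xi> i \<omega>\<bar> \<partial>P) \<le> \<sigma> * sqrt (card J)"
  \<comment> \<open>The empty sum is constant and has no density, so it is settled
    separately.\<close>
  proof (cases "J = {}")
    case False
    define \<tau> where "\<tau> = sqrt (\<Sum>i\<in>J. \<sigma>\<^sup>2)"
    have \<tau>: "\<tau> = \<sigma> * sqrt (card J)" using \<sigma> by (simp add: \<tau>_def real_sqrt_mult mult.commute)
    have \<tau>0: "\<tau> > 0" using \<sigma> J False by (simp add: \<tau> card_gt_0_iff)
    have "indep_vars (\<lambda>_. borel) \<xi> J" using iid J by (auto simp: iid_gaussian_def intro: indep_vars_subset)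
    moreover have "distributed P lborel (\<xi> i) (\<lambda>x. ennreal (normal_density 0 \<sigma> x))" if "i \<in> J" for i
      using iid J that by (auto simp: iid_gaussian_def)
    ultimately have D: "distributed P lborel (\<lambda>\<omega>. \<Sum>i\<in>J. \<xi> i \<omega>) (normal_density 0 \<tau>)"
      using sum_indep_normal[of J \<xi> "\<lambda>_. \<sigma>" "\<lambda>_. 0"] J(1) False \<sigma> by (simp add: \<tau>_def)
    have "integrable lborel (\<lambda>x. normal_density 0 \<tau> x * \<bar>x\<bar>)"
      using integrable_normal_moment_abs[OF \<tau>0, of 0 1] by simp
    then have "integrable P (\<lambda>\<omega>. \<bar>\<Sum>i\<in>J. \<xi> i \<omega>\<bar>)"
      using distributed_integrable[OF D, of abs] by simp
    moreover have "(\<integral>\<omega>. \<bar>\<Sum>i\<in>J. \<xi> i \<omega>\<bar> \<partial>P) = \<tau> * sqrt (2 / pi)"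
      using distributed_integral[OF D, of abs] integral_normal_moment_abs_odd[OF \<tau>0, of 0 0] by simp
    moreover have "\<tau> * sqrt (2 / pi) \<le> \<tau> * 1"
      using \<tau>0 pi_ge_two by (intro mult_left_mono) auto
    ultimately show ?thesis using \<tau> by simp
  qed auto
  then show "integrable P (\<lambda>\<omega>. \<bar>\<Sum>i\<in>J. \<xi> i \<omega>\<bar>)" "(\<integral>\<omega>. \<bar>\<Sum>i\<in>J. \<xi> i \<omega>\<bar> \<partial>P) \<le> \<sigma> * sqrt (card J)"
    by auto
qed

text \<open>A design point equal to 1 has index \<open>m\<close>, so the indices run over
  \<open>0, ..., m\<close>.\<close>

definition noise_cell :: "(nat \<Rightarrow> real) \<Rightarrow> nat \<Rightarrow> nat \<Rightarrow> nat \<Rightarrow> nat set" where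
  "noise_cell x m n j = {i\<in>{1..n}. nat \<lfloor>real m * x i\<rfloor> = j}"

text \<open>A bound for \<open>\<Sum>i. \<Delta> (x i) * \<xi> i\<close> that is uniform over bounded Lipschitz functions \<open>\<Delta>\<close>: on each of
  the cells of a grid of mesh \<open>1/m\<close> the function is replaced by a constant.\<close>

definition noise_bound :: "(nat \<Rightarrow> 'w \<Rightarrow> real) \<Rightarrow> (nat \<Rightarrow> real) \<Rightarrow> nat \<Rightarrow> nat \<Rightarrow> 'w \<Rightarrow> real" where
  "noise_bound \<xi> x m n \<omega> =
     (\<Sum>i=1..n. \<bar>\<xi> i \<omega>\<bar>) / m + (\<Sum>j\<le>m. \<bar>\<Sum>i\<in>noise_cell x m n j. \<xi> i \<omega>\<bar>)"

lemma noise_bound_uniform: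
  assumes m: "m \<ge> 1" and x: "\<forall>i\<ge>1. x i \<in> {0..1}" and M: "M \<ge> 0"
    and b: "\<And>t. t \<in> {0..1} \<Longrightarrow> \<bar>\<Delta> t\<bar> \<le> M"
    and L: "\<And>s t. s \<in> {0..1} \<Longrightarrow> t \<in> {0..1} \<Longrightarrow> \<bar>\<Delta> s - \<Delta> t\<bar> \<le> M * \<bar>s - t\<bar>"
  shows "\<bar>\<Sum>i=1..n. \<Delta> (x i) * \<xi> i \<omega>\<bar> \<le> M * noise_bound \<xi> x m n \<omega>"
proof -
  define c where "c i = nat \<lfloor>real m * x i\<rfloor>" for i
  have c: "c i \<le> m" "real (c i) / m \<in> {0..1}" "\<bar>x i - real (c i) / m\<bar> \<le> 1 / m" if "i \<in> {1..n}" for i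
  proof -
    have xi: "0 \<le> x i" "x i \<le> 1" using x that by auto
    have "real m * x i \<le> real m * 1" using xi by (intro mult_left_mono) auto
    then have *: "real (c i) \<le> real m * x i" "real m * x i < real (c i) + 1" "real (c i) \<le> m"
      using xi unfolding c_def by (auto simp: of_nat_nat) linarith+
    then show "c i \<le> m" "real (c i) / m \<in> {0..1}" using m by auto
    have "real (c i) / m \<le> x i" using * m by (simp add: divide_le_eq mult.commute)
    moreover have "x i \<le> (real (c i) + 1) / m" using * m by (simp add: le_divide_eq mult.commute)
    then have "x i - real (c i) / m \<le> 1 / m" by (simp add: add_divide_distrib)
    ultimately
    show "\<bar>x i - real (c i) / m\<bar> \<le> 1 / m" by linarith
  qed
  \<comment> \<open>Moving \<open>x i\<close> to the left end of its cell costs at most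
    \<open>M / m\<close> per unit of noise. The remaining sum has constant weights on each cell and
    factors through the cell sums.\<close>
  have "(\<Sum>i=1..n. \<Delta> (x i) * \<xi> i \<omega>) =
      (\<Sum>i=1..n. (\<Delta> (x i) - \<Delta> (real (c i) / m)) * \<xi> i \<omega>) + (\<Sum>i=1..n. \<Delta> (real (c i) / m) * \<xi> i \<omega>)"
    by (simp add: sum.distrib[symmetric] algebra_simps)
  moreover have "\<bar>\<Sum>i=1..n. (\<Delta> (x i) - \<Delta> (real (c i) / m)) * \<xi> i \<omega>\<bar> \<le> (\<Sum>i=1..n. M * (1 / m) * \<bar>\<xi> i \<omega>\<bar>)"
  proof (intro order.trans[OF sum_abs] sum_mono)
    fix i assume i: "i \<in> {1..n}"
    have "\<bar>\<Delta> (x i) - \<Delta> (real (c i) / m)\<bar> \<le> M * \<bar>x i - real (c i) / m\<bar>"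
      by (rule L) (use c[OF i] x i in auto)
    also have "\<dots> \<le> M * (1 / m)" using c(3)[OF i] M by (rule mult_left_mono)
    finally show "\<bar>(\<Delta> (x i) - \<Delta> (real (c i) / m)) * \<xi> i \<omega>\<bar> \<le> M * (1 / m) * \<bar>\<xi> i \<omega>\<bar>"
      unfolding abs_mult by (rule mult_right_mono) simp
  qed
  moreover have "\<bar>\<Sum>i=1..n. \<Delta> (real (c i) / m) * \<xi> i \<omega>\<bar> \<le> (\<Sum>j\<le>m. M * \<bar>\<Sum>i\<in>noise_cell x m n j. \<xi> i \<omega>\<bar>)"
  proof -
    have "(\<Sum>i=1..n. \<Delta> (real (c i) / m) * \<xi> i \<omega>) =
        (\<Sum>j\<le>m. \<Sum>i\<in>{i\<in>{1..n}. c i = j}. \<Delta> (real (c i) / m) * \<xi> i \<omega>)"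
      using c(1) by (intro sum.group[symmetric]) auto
    also have "\<dots> = (\<Sum>j\<le>m. \<Delta> (real j / m) * (\<Sum>i\<in>noise_cell x m n j. \<xi> i \<omega>))"
      unfolding noise_cell_def c_def by (intro sum.cong refl) (simp add: sum_distrib_left)
    also have "\<bar>\<dots>\<bar> \<le> (\<Sum>j\<le>m. M * \<bar>\<Sum>i\<in>noise_cell x m n j. \<xi> i \<omega>\<bar>)"
    proof (intro order.trans[OF sum_abs] sum_mono)
      fix j assume "j \<in> {..m}"
      then have "\<bar>\<Delta> (real j / m)\<bar> \<le> M" using m by (intro b) auto
      then show "\<bar>\<Delta> (real j / m) * (\<Sum>i\<in>noise_cell x m n j. \<xi> i \<omega>)\<bar> \<le> M * \<bar>\<Sum>i\<in>noise_cell x m n j. \<xi> i \<omega>\<bar>"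
        unfolding abs_mult by (rule mult_right_mono) simp
    qed
    finally show ?thesis .
  qed
  ultimately have "\<bar>\<Sum>i=1..n. \<Delta> (x i) * \<xi> i \<omega>\<bar> \<le>
      (\<Sum>i=1..n. M * (1 / m) * \<bar>\<xi> i \<omega>\<bar>) + (\<Sum>j\<le>m. M * \<bar>\<Sum>i\<in>noise_cell x m n j. \<xi> i \<omega>\<bar>)"
    by linarith
  also have "\<dots> = M * noise_bound \<xi> x m n \<omega>"
    by (simp add: noise_bound_def sum_distrib_left sum_divide_distrib distrib_left)
  finally show ?thesis .
qed

text \<open>Discretisation contributes at the scale \<open>n / m\<close>. By independence each cell
  sum is only of order \<open>sqrt n\<close>, so for fixed \<open>m\<close> the second term is of
  smaller order than \<open>n\<close>.\<close>

lemma noise_bound_integral: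
  assumes P: "prob_space P" and \<sigma>: "\<sigma> > 0" and iid: "iid_gaussian P \<sigma> \<xi>" and m: "m \<ge> 1"
  shows "integrable P (noise_bound \<xi> x m n)"
    "(\<integral>\<omega>. noise_bound \<xi> x m n \<omega> \<partial>P) \<le> \<sigma> * real n / real m + (real m + 1) * (\<sigma> * sqrt (real n))"
proof -
  note g = gaussian_sum_abs_bound[OF P \<sigma> iid]
  have cell: "finite (noise_cell x m n j)" "noise_cell x m n j \<subseteq> {1..}" "card (noise_cell x m n j) \<le> n" for j
  proof -
    have "card (noise_cell x m n j) \<le> card {1..n}" by (intro card_mono) (auto simp: noise_cell_def)
    then show "card (noise_cell x m n j) \<le> n" by simp
  qed (auto simp: noise_cell_def)
  have i1: "integrable P (\<lambda>\<omega>. \<bar>\<xi> i \<omega>\<bar>)" if "i \<in> {1..n}" for i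
    using g(1)[of "{i}"] that by simp
  have i2: "integrable P (\<lambda>\<omega>. \<bar>\<Sum>i\<in>noise_cell x m n j. \<xi> i \<omega>\<bar>)" for j
    by (rule g(1)[OF cell(1,2)])
  have I1: "integrable P (\<lambda>\<omega>. (\<Sum>i=1..n. \<bar>\<xi> i \<omega>\<bar>) / m)"
    by (intro Bochner_Integration.integrable_sum integrable_divide i1)
  have I2: "integrable P (\<lambda>\<omega>. \<Sum>j\<le>m. \<bar>\<Sum>i\<in>noise_cell x m n j. \<xi> i \<omega>\<bar>)"
    by (intro Bochner_Integration.integrable_sum i2)
  show "integrable P (noise_bound \<xi> x m n)"
    unfolding noise_bound_def by (intro Bochner_Integration.integrable_add I1 I2)
  have "(\<integral>\<omega>. noise_bound \<xi> x m n \<omega> \<partial>P) =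
      (\<Sum>i=1..n. \<integral>\<omega>. \<bar>\<xi> i \<omega>\<bar> \<partial>P) / m + (\<Sum>j\<le>m. \<integral>\<omega>. \<bar>\<Sum>i\<in>noise_cell x m n j. \<xi> i \<omega>\<bar> \<partial>P)"
    unfolding noise_bound_def Bochner_Integration.integral_add[OF I1 I2]
    using i1 i2 by (simp add: Bochner_Integration.integral_sum del: sum.insert sum.empty)
  moreover have "(\<Sum>i=1..n. \<integral>\<omega>. \<bar>\<xi> i \<omega>\<bar> \<partial>P) / m \<le> (\<Sum>i=1..n. \<sigma>) / m"
  proof (intro divide_right_mono sum_mono)
    fix i assume "i \<in> {1..n}"
    then show "(\<integral>\<omega>. \<bar>\<xi> i \<omega>\<bar> \<partial>P) \<le> \<sigma>" using g(2)[of "{i}"] by simp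
  qed simp
  moreover have "(\<Sum>j\<le>m. \<integral>\<omega>. \<bar>\<Sum>i\<in>noise_cell x m n j. \<xi> i \<omega>\<bar> \<partial>P) \<le> (\<Sum>j\<le>m. \<sigma> * sqrt n)"
  proof (rule sum_mono)
    fix j
    have "(\<integral>\<omega>. \<bar>\<Sum>i\<in>noise_cell x m n j. \<xi> i \<omega>\<bar> \<partial>P) \<le> \<sigma> * sqrt (card (noise_cell x m n j))"
      by (rule g(2)[OF cell(1,2)])
    also have "\<dots> \<le> \<sigma> * sqrt n" using \<sigma> cell(3) by (intro mult_left_mono) auto
    finally show "(\<integral>\<omega>. \<bar>\<Sum>i\<in>noise_cell x m n j. \<xi> i \<omega>\<bar> \<partial>P) \<le> \<sigma> * sqrt n" .
  qed
  ultimately show "(\<integral>\<omega>. noise_bound \<xi> x m n \<omega> \<partial>P) \<le> \<sigma> * real n / real m + (real m + 1) * (\<sigma> * sqrt (real n))"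
    by (simp add: algebra_simps)
qed

lemma noise_bound_nonneg: "noise_bound \<xi> x m n \<omega> \<ge> 0"
  unfolding noise_bound_def by (intro add_nonneg_nonneg divide_nonneg_nonneg sum_nonneg) auto

text \<open>Markov's inequality. The mesh is fixed first to make the discretisation term small
  relative to \<open>\<eta> * n\<close>; then \<open>n\<close> is taken large enough to absorb the
  factor \<open>m + 1\<close>.\<close>

lemma noise_bound_small:
  fixes \<eta> e :: real
  assumes P: "prob_space P" and \<sigma>: "\<sigma> > 0" and iid: "iid_gaussian P \<sigma> \<xi>" and \<eta>: "\<eta> > 0" and e: "e > 0"
  obtains m N where "m \<ge> 1" "N \<ge> 1"
    "\<And>n. n \<ge> N \<Longrightarrow> measure P {\<omega> \<in> space P. noise_bound \<xi> x m n \<omega> \<ge> \<eta> * n} \<le> e"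
proof -
  obtain m :: nat where m: "m \<ge> 1" "\<sigma> / (\<eta> * m) \<le> e / 2"
  proof -
    obtain m :: nat where "real m \<ge> 2 * \<sigma> / (\<eta> * e) + 1" using real_arch_simple by blast
    moreover have "2 * \<sigma> / (\<eta> * e) \<ge> 0" using \<sigma> \<eta> e by simp
    ultimately have m: "real m \<ge> 1" "real m \<ge> 2 * \<sigma> / (\<eta> * e)" by linarith+
    then have "\<sigma> / (\<eta> * m) \<le> e / 2" using \<eta> e by (simp add: field_simps)
    with m that show ?thesis by auto
  qed
  obtain N :: nat where N: "N \<ge> 1" "(real m + 1) * \<sigma> / \<eta> \<le> e / 2 * sqrt N"
  proof -
    define B where "B = (real m + 1) * \<sigma> / \<eta> / (e / 2)"
    have B: "B \<ge> 0" using \<sigma> \<eta> e by (simp add: B_def)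
    obtain N :: nat where "real N \<ge> B\<^sup>2 + 1" using real_arch_simple by blast
    then have "real N \<ge> 1" "real N \<ge> B\<^sup>2" using zero_le_power2[of B] by linarith+
    then have "N \<ge> 1" "sqrt N \<ge> B" using B real_le_rsqrt[of B N] by auto
    have "(real m + 1) * \<sigma> / \<eta> = e / 2 * B" using e by (simp add: B_def)
    also have "\<dots> \<le> e / 2 * sqrt N" using \<open>sqrt N \<ge> B\<close> e by (intro mult_left_mono) auto
    finally show ?thesis using that \<open>N \<ge> 1\<close> by blast
  qed
  show thesis
  proof (rule that[OF m(1) N(1)])
    fix n assume n: "n \<ge> N"
    have n0: "real n > 0" using n N by auto
    have "measure P {\<omega> \<in> space P. noise_bound \<xi> x m n \<omega> \<ge> \<eta> * n} \<le> (\<integral>\<omega>. noise_bound \<xi> x m n \<omega> \<partial>P) / (\<eta> * n)"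
      by (rule integral_Markov_inequality_measure[OF noise_bound_integral(1)[OF P \<sigma> iid m(1)] sets.empty_sets])
        (use \<eta> n0 in \<open>auto simp: noise_bound_nonneg\<close>)
    also have "\<dots> \<le> (\<sigma> * real n / real m + (real m + 1) * (\<sigma> * sqrt (real n))) / (\<eta> * n)"
      using \<eta> n0 by (intro divide_right_mono noise_bound_integral(2)[OF P \<sigma> iid m(1)]) auto
    also have "\<dots> = \<sigma> / (\<eta> * m) + (real m + 1) * \<sigma> / \<eta> / sqrt n"
    proof -
      have "\<sigma> * real n / real m / (\<eta> * n) = \<sigma> / (\<eta> * m)" using n0 by simp
      moreover have "(real m + 1) * (\<sigma> * sqrt n) / (\<eta> * n) = (real m + 1) * \<sigma> / \<eta> * (sqrt n / n)" by simp
      moreover have "sqrt n / n = 1 / sqrt n"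
        using sqrt_divide_self_eq[of n] by (simp add: divide_inverse)
      ultimately show ?thesis by (simp only: add_divide_distrib times_divide_eq_right mult_1_right)
    qed
    also have "(real m + 1) * \<sigma> / \<eta> / sqrt n \<le> e / 2"
    proof -
      have "(real m + 1) * \<sigma> / \<eta> \<le> e / 2 * sqrt N" by (rule N(2))
      also have "\<dots> \<le> e / 2 * sqrt n" using n e by (intro mult_left_mono) auto
      finally show ?thesis using n0 by (subst pos_divide_le_eq) auto
    qed
    finally show "measure P {\<omega> \<in> space P. noise_bound \<xi> x m n \<omega> \<ge> \<eta> * n} \<le> e"
      using m(2) by linarith
  qed
qed

text \<open>A Lipschitz function exceeding \<open>\<kappa>\<close> somewhere exceeds \<open>\<kappa>/2\<close> on a whole grid cell, which contains
  a fixed proportion of the design points.\<close>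

lemma design_separates:
  assumes dd: "\<exists>K>0. \<forall>b\<in>{0..1}. \<forall>c\<in>{0..1}. b < c \<longrightarrow>
      (\<exists>N. \<forall>n>N. empirical_cdf x n c - empirical_cdf x n b \<ge> K * (c - b))"
    and \<kappa>: "\<kappa> > 0" and M: "M \<ge> 0"
  obtains c N where "c > 0"
    "\<And>n \<Delta>. \<lbrakk>n > N; \<forall>s\<in>{0..1}. \<forall>t\<in>{0..1}. \<bar>\<Delta> s - \<Delta> t\<bar> \<le> M * \<bar>s - t\<bar>; \<exists>t\<in>{0..1}. \<bar>\<Delta> t\<bar> > \<kappa>\<rbrakk> \<Longrightarrow>
      (\<Sum>i=1..n. (\<Delta> (x i))\<^sup>2) \<ge> c * real n"
proof -
  obtain K where K: "K > 0" "\<And>b c. b \<in> {0..1} \<Longrightarrow> c \<in> {0..1} \<Longrightarrow> b < c \<Longrightarrow>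
      \<exists>N. \<forall>n>N. empirical_cdf x n c - empirical_cdf x n b \<ge> K * (c - b)" using dd by blast
  \<comment> \<open>On a cell of length \<open>1 / m\<close> the function then varies by at most
    \<open>\<kappa> / 2\<close>.\<close>
  obtain m :: nat where m: "m \<ge> 1" "M / m \<le> \<kappa> / 2"
  proof -
    obtain m :: nat where "real m \<ge> 2 * M / \<kappa> + 1" using real_arch_simple by blast
    moreover have "2 * M / \<kappa> \<ge> 0" using M \<kappa> by simp
    ultimately have m: "real m \<ge> 1" "real m \<ge> 2 * M / \<kappa>" by linarith+
    then have "M / m \<le> \<kappa> / 2" using \<kappa> by (simp add: field_simps)
    with m that show ?thesis by auto
  qed
  have cell: "real j / m \<in> {0..1}" "real (Suc j) / m \<in> {0..1}" "real j / m < real (Suc j) / m"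
    "real (Suc j) / m - real j / m = 1 / m" if "j < m" for j
    using that m by (auto simp: field_simps)
  have "\<exists>N. \<forall>j<m. \<forall>n>N j. empirical_cdf x n (real (Suc j) / m) - empirical_cdf x n (real j / m) \<ge> K * (1 / m)"
    using K(2)[OF cell(1,2,3)] cell(4) by metis
  then obtain N where N: "\<And>j n. j < m \<Longrightarrow> n > N j \<Longrightarrow>
      empirical_cdf x n (real (Suc j) / m) - empirical_cdf x n (real j / m) \<ge> K * (1 / m)" by blast
  \<comment> \<open>The hypothesis gives one threshold per pair of points. Finitely many cells allow
    a threshold independent of \<open>\<Delta>\<close>.\<close>
  define N0 where "N0 = Max (N ` {..<m})"
  have N0: "N j \<le> N0" if "j < m" for j using that by (auto simp: N0_def)
  show thesis
  proof (rule that[of "(\<kappa> / 2)\<^sup>2 * (K / m)" N0])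
    show "(\<kappa> / 2)\<^sup>2 * (K / m) > 0" using \<kappa> K m by simp
    fix n \<Delta> assume n: "n > N0" and L: "\<forall>s\<in>{0..1}. \<forall>t\<in>{0..1}. \<bar>\<Delta> s - \<Delta> t\<bar> \<le> M * \<bar>s - t\<bar>"
      and "\<exists>t\<in>{0..1}. \<bar>\<Delta> t\<bar> > \<kappa>"
    then obtain t where t: "t \<in> {0..1}" "\<bar>\<Delta> t\<bar> > \<kappa>" by blast
    \<comment> \<open>The minimum assigns \<open>t = 1\<close> to the last cell.\<close>
    define j where "j = min (m - 1) (nat \<lfloor>real m * t\<rfloor>)"
    have j: "j < m" "real j \<le> real m * t" "real m * t \<le> real j + 1"
    proof -
      have mt: "0 \<le> real m * t" "real m * t \<le> real m" using t m by (auto simp: mult_left_le)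
      then have *: "real (nat \<lfloor>real m * t\<rfloor>) \<le> real m * t" "real m * t < real (nat \<lfloor>real m * t\<rfloor>) + 1"
        by (auto simp: of_nat_nat)
      show "j < m" using m by (auto simp: j_def)
      show "real j \<le> real m * t" using * by (auto simp: j_def min_def)
      show "real m * t \<le> real j + 1" using * mt m by (auto simp: j_def min_def of_nat_diff)
    qed
    \<comment> \<open>Half open on the left, so that its cardinality is \<open>n\<close> times an
      increment of the empirical distribution function.\<close>
    define I where "I = {i\<in>{1..n}. real j / m < x i \<and> x i \<le> real (Suc j) / m}"
    have big: "(\<kappa> / 2)\<^sup>2 \<le> (\<Delta> (x i))\<^sup>2" if "i \<in> I" for i
    proof -
      have "0 \<le> real j / m" by simp
      then have xi: "x i \<in> {0..1}" using that cell(2)[OF j(1)] unfolding I_def atLeastAtMost_iff mem_Collect_eq by linarith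
      have "real j / m \<le> t" "t \<le> real (Suc j) / m" using j m by (auto simp: field_simps)
      then have "\<bar>t - x i\<bar> \<le> 1 / m" using that cell(4)[OF j(1)] unfolding I_def by auto
      then have "M * \<bar>t - x i\<bar> \<le> M * (1 / m)" using M by (rule mult_left_mono)
      moreover have "\<bar>\<Delta> t - \<Delta> (x i)\<bar> \<le> M * \<bar>t - x i\<bar>" using L t(1) xi by blast
      ultimately have "\<bar>\<Delta> t - \<Delta> (x i)\<bar> \<le> \<kappa> / 2" using m(2) by (simp only: times_divide_eq_right mult_1_right)
      then have "\<bar>\<Delta> (x i)\<bar> \<ge> \<kappa> / 2" using t(2) by linarith
      then show ?thesis using \<kappa> by (metis abs_le_square_iff abs_of_pos half_gt_zero)
    qed
    have "K / m * n \<le> card I"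
    proof -
      have n0: "real n > 0" using n by auto
      have "{i\<in>{1..n}. x i \<le> real j / m} \<subseteq> {i\<in>{1..n}. x i \<le> real (Suc j) / m}"
        using cell(3)[OF j(1)] by auto
      then have "real (card {i\<in>{1..n}. x i \<le> real (Suc j) / m}) - real (card {i\<in>{1..n}. x i \<le> real j / m}) =
          real (card ({i\<in>{1..n}. x i \<le> real (Suc j) / m} - {i\<in>{1..n}. x i \<le> real j / m}))"
        by (subst card_Diff_subset) (auto simp: of_nat_diff card_mono)
      also have "{i\<in>{1..n}. x i \<le> real (Suc j) / m} - {i\<in>{1..n}. x i \<le> real j / m} = I"
        by (auto simp: I_def)
      finally have "empirical_cdf x n (real (Suc j) / m) - empirical_cdf x n (real j / m) = card I / n"
        by (simp add: empirical_cdf_def diff_divide_distrib[symmetric])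
      moreover have "n > N j" using n N0[OF j(1)] by linarith
      ultimately have "K * (1 / m) \<le> card I / n" using N[OF j(1)] by metis
      then show ?thesis using n0 by (simp add: field_simps)
    qed
    then have "(\<kappa> / 2)\<^sup>2 * (K / m * n) \<le> (\<kappa> / 2)\<^sup>2 * card I" by (intro mult_left_mono) auto
    also have "\<dots> = (\<Sum>i\<in>I. (\<kappa> / 2)\<^sup>2)" by simp
    also have "\<dots> \<le> (\<Sum>i\<in>I. (\<Delta> (x i))\<^sup>2)" by (intro sum_mono big)
    also have "\<dots> \<le> (\<Sum>i=1..n. (\<Delta> (x i))\<^sup>2)" by (intro sum_mono2) (auto simp: I_def)
    finally show "(\<Sum>i=1..n. (\<Delta> (x i))\<^sup>2) \<ge> (\<kappa> / 2)\<^sup>2 * (K / m) * real n" by (simp add: mult.assoc)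
  qed
qed

section \<open>The posterior\<close>

text \<open>Unlike \<open>density_cong\<close>, this allows a density that is not measurable.\<close>

lemma density_cong_AE_nonmeasurable:
  assumes "AE x in M. f x = g x"
  shows "density M f = density M g"
proof -
  have "(\<integral>\<^sup>+x. f x * indicator A x \<partial>M) = (\<integral>\<^sup>+x. g x * indicator A x \<partial>M)" for A
    by (rule nn_integral_cong_AE) (use assms in auto)
  then show ?thesis by (simp add: density_def)
qed

text \<open>\<open>W\<close> stands for a measurable version of the likelihood. Its values in
  \<open>(0, 1]\<close> make the normalising constant finite and positive, which turns the posterior
  mass into a ratio of real integrals.\<close>

lemma measure_posterior:
  assumes P: "prob_space \<mu>0" and W[measurable]: "W \<in> borel_measurable \<mu>0"
    and W01: "\<And>a. 0 < W a \<and> W a \<le> 1"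
    and L: "AE a in \<mu>0. likelihood f \<sigma> x y n a = W a" and B[measurable]: "B \<in> sets \<mu>0"
  shows "measure (posterior f \<sigma> \<mu>0 x y n) B = (\<integral>a. indicator B a * W a \<partial>\<mu>0) / (\<integral>a. W a \<partial>\<mu>0)"
    "integrable \<mu>0 W" "(\<integral>a. W a \<partial>\<mu>0) > 0"
proof -
  interpret prob_space \<mu>0 by (rule P)
  show int: "integrable \<mu>0 W"
    by (rule integrable_const_bound[of _ 1]) (use W01 in \<open>auto simp: less_imp_le\<close>)
  show pos: "(\<integral>a. W a \<partial>\<mu>0) > 0"
  proof -
    have "(\<integral>a. W a \<partial>\<mu>0) \<ge> 0" using W01 by (intro integral_nonneg_AE) (auto simp: less_imp_le)
    moreover have "(\<integral>a. W a \<partial>\<mu>0) \<noteq> 0"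
    proof
      assume "(\<integral>a. W a \<partial>\<mu>0) = 0"
      then have "AE a in \<mu>0. W a = 0"
        using integral_nonneg_eq_0_iff_AE[OF int] W01 by (auto simp: less_imp_le)
      then have "AE a in \<mu>0. False" using W01 by (auto simp: less_le)
      then show False by simp
    qed
    ultimately show ?thesis by linarith
  qed
  define z where "z = (\<integral>a. W a \<partial>\<mu>0)"
  have "(\<integral>\<^sup>+b. ennreal (likelihood f \<sigma> x y n b) \<partial>\<mu>0) = (\<integral>\<^sup>+b. ennreal (W b) \<partial>\<mu>0)"
    by (rule nn_integral_cong_AE) (use L in auto)
  also have "\<dots> = ennreal z"
    unfolding z_def by (rule nn_integral_eq_integral[OF int]) (use W01 in \<open>auto simp: less_imp_le\<close>)
  finally have Z: "(\<integral>\<^sup>+b. ennreal (likelihood f \<sigma> x y n b) \<partial>\<mu>0) = ennreal z" .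
  have "posterior f \<sigma> \<mu>0 x y n = density \<mu>0 (\<lambda>a. ennreal (W a / z))"
    unfolding posterior_def Z
    by (rule density_cong_AE_nonmeasurable)
      (use L W01 pos in \<open>auto simp: z_def divide_ennreal less_imp_le\<close>)
  then have "emeasure (posterior f \<sigma> \<mu>0 x y n) B = (\<integral>\<^sup>+a. ennreal (W a / z) * indicator B a \<partial>\<mu>0)"
    by (simp add: emeasure_density)
  also have "\<dots> = (\<integral>\<^sup>+a. ennreal (indicator B a * W a / z) \<partial>\<mu>0)"
    by (intro nn_integral_cong) (auto split: split_indicator)
  also have "\<dots> = ennreal (\<integral>a. indicator B a * W a / z \<partial>\<mu>0)"
  proof (rule nn_integral_eq_integral)
    show "integrable \<mu>0 (\<lambda>a. indicator B a * W a / z)"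
      using integrable_real_mult_indicator[OF B int] by (intro integrable_divide) (simp add: mult.commute)
  qed (use W01 pos in \<open>auto simp: z_def less_imp_le\<close>)
  finally show "measure (posterior f \<sigma> \<mu>0 x y n) B = (\<integral>a. indicator B a * W a \<partial>\<mu>0) / (\<integral>a. W a \<partial>\<mu>0)"
    using W01 pos by (simp add: measure_def z_def enn2real_ennreal integral_nonneg_AE less_imp_le)
qed

text \<open>The unnormalised mass outside \<open>B\<close> is at most \<open>E1\<close>, and the
  total mass is at least the part from \<open>U\<close>, that is
  \<open>E2 * measure M U\<close>.\<close>

lemma weighted_ratio_bound:
  fixes W :: "'a \<Rightarrow> real"
  assumes P: "prob_space M" and int: "integrable M W" and pos: "(\<integral>a. W a \<partial>M) > 0"
    and B: "B \<in> sets M" and U: "U \<in> sets M" "measure M U > 0" and W0: "\<And>a. W a \<ge> 0"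
    and out: "AE a in M. a \<notin> B \<longrightarrow> W a \<le> E1" and inside: "AE a in M. a \<in> U \<longrightarrow> W a \<ge> E2"
    and E: "E1 \<ge> 0" "E2 > 0"
  shows "(\<integral>a. indicator B a * W a \<partial>M) / (\<integral>a. W a \<partial>M) \<ge> 1 - E1 / (E2 * measure M U)"
proof -
  interpret prob_space M by (rule P)
  have iB: "integrable M (\<lambda>a. indicator B a * W a)"
    using integrable_real_mult_indicator[OF B int] by (simp add: mult.commute)
  have "(\<integral>a. W a \<partial>M) - (\<integral>a. indicator B a * W a \<partial>M) = (\<integral>a. W a - indicator B a * W a \<partial>M)"
    using int iB by (rule Bochner_Integration.integral_diff[symmetric])
  also have "\<dots> \<le> (\<integral>a. E1 \<partial>M)"
    by (intro integral_mono_AE) (use int iB out E in \<open>auto split: split_indicator elim!: eventually_mono\<close>)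
  also have "\<dots> = E1" by (simp add: prob_space)
  finally have 1: "(\<integral>a. W a \<partial>M) - (\<integral>a. indicator B a * W a \<partial>M) \<le> E1" .
  have "E2 * measure M U = (\<integral>a. indicator U a * E2 \<partial>M)"
    using U sets.sets_into_space[OF U(1)] by (simp add: mult.commute Int_absorb1)
  also have "\<dots> \<le> (\<integral>a. W a \<partial>M)"
  proof (rule integral_mono_AE[OF _ int])
    show "integrable M (\<lambda>a. indicator U a * E2)"
      using integrable_real_mult_indicator[OF U(1), of "\<lambda>_. E2"] by (simp add: mult.commute)
    show "AE a in M. indicator U a * E2 \<le> W a"
      using inside by eventually_elim (use W0 in \<open>auto split: split_indicator\<close>)
  qed
  finally have 2: "E2 * measure M U \<le> (\<integral>a. W a \<partial>M)" .
  have "1 - (\<integral>a. indicator B a * W a \<partial>M) / (\<integral>a. W a \<partial>M) = ((\<integral>a. W a \<partial>M) - (\<integral>a. indicator B a * W a \<partial>M)) / (\<integral>a. W a \<partial>M)"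
    using pos by (simp add: diff_divide_distrib)
  also have "\<dots> \<le> E1 / (E2 * measure M U)"
    using 1 2 E U by (intro frac_le) auto
  finally show ?thesis by linarith
qed

section \<open>A measurable version of the forward map\<close>

definition eval_ext :: "(real \<Rightarrow> real) \<Rightarrow> real \<Rightarrow> real" where
  "eval_ext a t = lim (\<lambda>n. a (grid_approx n t))"

lemma eval_ext_eq:
  assumes "continuous_on {0..1} a" "t \<in> {0..1}"
  shows "eval_ext a t = a t"
  unfolding eval_ext_def by (rule limI) (rule continuous_grid_approx[OF assms])

text \<open>The grid point is determined by an integer depending measurably on \<open>t\<close>, and
  for each fixed integer the evaluation is measurable in \<open>a\<close>. Countably many pieces
  give joint measurability, which passes to the limit.\<close>

lemma eval_ext_measurable:
  assumes "prior_measure \<mu>"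
  shows "(\<lambda>(a, t). eval_ext a t) \<in> borel_measurable (\<mu> \<Otimes>\<^sub>M lborel)"
proof -
  have "(\<lambda>p. fst p (grid_approx n (snd p))) \<in> borel_measurable (\<mu> \<Otimes>\<^sub>M lborel)" for n
  proof -
    have "(\<lambda>p. fst p (max 0 (min 1 (of_int i / real (Suc n))))) \<in> borel_measurable (\<mu> \<Otimes>\<^sub>M lborel)" for i :: int
      by (rule measurable_compose[OF measurable_fst]) (use assms in \<open>auto simp: prior_measure_def\<close>)
    moreover have "(\<lambda>p. \<lfloor>real (Suc n) * snd p\<rfloor>) \<in> measurable (\<mu> \<Otimes>\<^sub>M lborel) (count_space UNIV)"
      by measurable
    ultimately show ?thesis
      unfolding grid_approx_def
      by (rule measurable_compose_countable[where f = "\<lambda>i p. fst p (max 0 (min 1 (of_int i / real (Suc n))))"])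
  qed
  then show ?thesis unfolding eval_ext_def case_prod_beta by (rule borel_measurable_lim_metric)
qed

lemma LBINT_Icc_eq_integral:
  fixes g :: "real \<Rightarrow> real"
  assumes "continuous_on {a..b} g" "\<And>t. t \<in> {a..b} \<Longrightarrow> h t = g t"
  shows "(\<integral>t. indicator {a..b} t * h t \<partial>lborel) = integral {a..b} g"
proof -
  have "(\<integral>t. indicator {a..b} t * h t \<partial>lborel) = (LINT t:{a..b}|lborel. g t)"
    unfolding set_lebesgue_integral_def
    by (rule Bochner_Integration.integral_cong) (use assms(2) in \<open>auto split: split_indicator\<close>)
  also have "\<dots> = integral {a..b} g"
    by (rule set_borel_integral_eq_integral(2)[OF borel_integrable_atLeastAtMost'[OF assms(1)]])
  finally show ?thesis .
qed

text \<open>In the explicit solution formula, \<open>eval_ext\<close> replaces the coefficient and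
  Lebesgue integrals replace gauge integrals. Parameter integrals of jointly measurable functions
  are measurable.\<close>

lemma forward_measurable_version:
  assumes \<mu>: "prior_measure \<mu>" and f: "continuous_on {0..1} f"
  obtains \<Phi> :: "real \<Rightarrow> (real \<Rightarrow> real) \<Rightarrow> real" where "\<And>x. \<Phi> x \<in> borel_measurable \<mu>"
    "\<And>x a. \<lbrakk>x \<in> {0..1}; a \<in> space \<mu>; \<forall>t\<in>{0..1}. a t > 0\<rbrakk> \<Longrightarrow> forward f a x = \<Phi> x a"
proof -
  define G where "G t = indicator {0..1} t *\<^sub>R source_int f t" for t
  have G[measurable]: "G \<in> borel_measurable borel"
    unfolding G_def by (rule borel_measurable_continuous_on_indicator[OF _ source_int_continuous[OF f]]) simp
  note [measurable] = eval_ext_measurable[OF \<mu>]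
  \<comment> \<open>The numerator \<open>h\<close> may depend on the coefficient, as the flux
    constant does.\<close>
  define I where "I h x a = (\<integral>t. indicator {0..x} t * (h a t / eval_ext a t) \<partial>lborel)" for h x a
  have I_meas: "I h x \<in> borel_measurable \<mu>"
    if [measurable]: "case_prod h \<in> borel_measurable (\<mu> \<Otimes>\<^sub>M lborel)" for h x
    unfolding I_def by measurable
  have I_eq: "I h x a = integral {0..x} (\<lambda>t. g t / a t)"
    if "continuous_on {0..1} g" "\<And>t. t \<in> {0..1} \<Longrightarrow> h a t = g t" "x \<in> {0..1}" "continuous_on {0..1} a" "\<forall>t\<in>{0..1}. a t > 0"
    for h x a g unfolding I_def
  proof (rule LBINT_Icc_eq_integral)
    show "continuous_on {0..x} (\<lambda>t. g t / a t)"
      by (rule continuous_on_subset[OF continuous_on_divide_pos[OF that(1,4,5)]]) (use that(3) in auto)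
    show "h a t / eval_ext a t = g t / a t" if "t \<in> {0..x}" for t
      using that \<open>x \<in> {0..1}\<close> eval_ext_eq[OF \<open>continuous_on {0..1} a\<close>, of t] \<open>\<And>t. _ \<Longrightarrow> h a t = g t\<close> by auto
  qed
  define C where "C a = I (\<lambda>a. G) 1 a / I (\<lambda>a t. 1) 1 a" for a
  have C[measurable]: "C \<in> borel_measurable \<mu>"
    unfolding C_def by (intro borel_measurable_divide I_meas) measurable
  define \<Phi> where "\<Phi> = I (\<lambda>a t. C a - G t)"
  show thesis
  proof (rule that)
    show "\<Phi> x \<in> borel_measurable \<mu>" for x :: real
      unfolding \<Phi>_def by (intro I_meas) measurable
    fix x :: real and a assume x: "x \<in> {0..1}" and a: "a \<in> space \<mu>" and pos: "\<forall>t\<in>{0..1}. a t > 0"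
    have ac: "continuous_on {0..1} a" using a \<mu> by (auto simp: prior_measure_def)
    note F = source_int_continuous[OF f]
    have "C a = flux_const f a"
      unfolding C_def flux_const_def
      using I_eq[OF F, of "\<lambda>a. G" a 1] I_eq[OF continuous_on_const, of "\<lambda>a t. 1" a 1 1] ac pos
      by (simp add: G_def)
    moreover have "\<Phi> x a = integral {0..x} (\<lambda>t. (C a - source_int f t) / a t)"
      unfolding \<Phi>_def
      by (rule I_eq) (use x ac pos in \<open>auto simp: G_def intro!: continuous_intros F\<close>)
    ultimately show "forward f a x = \<Phi> x a"
      using x by (simp add: forward_eq[OF f ac pos] elliptic_sol_def)
  qed
qed

section \<open>Posterior consistency\<close>

text \<open>Since \<open>emeasure\<close> is zero off the sigma-algebra, \<open>A\<close> is
  measurable; having positive mass, it cannot lie within an exceptional null set.\<close>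

lemma AE_pos_emeasure_ex:
  assumes "AE a in M. Q a" "emeasure M A > 0"
  shows "\<exists>a\<in>A. a \<in> space M \<and> Q a"
proof (rule ccontr)
  assume *: "\<not> ?thesis"
  have A: "A \<in> sets M" using assms(2) emeasure_notin_sets by fastforce
  have "AE a in M. a \<notin> A" using assms(1) AE_space by eventually_elim (use * in auto)
  then have "emeasure M A = 0"
    using AE_iff_measurable[OF A, of "\<lambda>a. a \<notin> A"] sets.sets_into_space[OF A] by auto
  with assms(2) show False by simp
qed

lemma holder_norm_less_imp_abs_le:
  assumes "holder_norm \<gamma> u < ennreal r" "r > 0" "t \<in> {0..1}"
  shows "\<bar>u t\<bar> \<le> r"
proof -
  have "holder_bounded \<gamma> r u" by (rule holder_norm_le_imp_bounded) (use assms in auto)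
  then have "\<bar>D01 0 u t\<bar> \<le> r" using assms(3) unfolding holder_bounded_def by blast
  then show ?thesis by simp
qed

text \<open>With \<open>v\<close> the noise, the first factor is the same for all coefficients and
  cancels from the posterior ratio.\<close>

lemma gaussian_likelihood_expand:
  fixes u v :: "nat \<Rightarrow> real"
  shows "exp (- (\<Sum>i=1..n. (u i - v i)\<^sup>2 / (2 * \<sigma>\<^sup>2))) =
     exp (- (\<Sum>i=1..n. (v i)\<^sup>2) / (2 * \<sigma>\<^sup>2)) *
     exp (- ((\<Sum>i=1..n. (u i)\<^sup>2) - 2 * (\<Sum>i=1..n. u i * v i)) / (2 * \<sigma>\<^sup>2))"
proof -
  have "(\<Sum>i=1..n. (u i - v i)\<^sup>2) = (\<Sum>i=1..n. (u i)\<^sup>2 + (v i)\<^sup>2 - 2 * (u i * v i))"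
    by (intro sum.cong) (auto simp: power2_diff)
  also have "\<dots> = (\<Sum>i=1..n. (v i)\<^sup>2) + ((\<Sum>i=1..n. (u i)\<^sup>2) - 2 * (\<Sum>i=1..n. u i * v i))"
    by (simp add: sum.distrib sum_subtractf sum_distrib_left)
  finally have *: "(\<Sum>i=1..n. (u i - v i)\<^sup>2) =
      (\<Sum>i=1..n. (v i)\<^sup>2) + ((\<Sum>i=1..n. (u i)\<^sup>2) - 2 * (\<Sum>i=1..n. u i * v i))" .
  have neg: "- ((p + q) / d) = - p / d + - q / d" for p q d :: real
    by (simp add: add_divide_distrib)
  show ?thesis unfolding sum_divide_distrib[symmetric] * neg exp_add ..
qed

theorem theorem4p5:
  fixes f a_dagger :: "real \<Rightarrow> real"
    and \<mu>0 :: "(real \<Rightarrow> real) measure"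
    and P :: "'w measure"
    and \<xi> :: "nat \<Rightarrow> 'w \<Rightarrow> real"
    and x :: "nat \<Rightarrow> real"
    and \<sigma> f_min a_min L \<gamma> \<gamma>' :: real
  assumes f_smooth: "smooth01 f"
    and f_min: "f_min > 0" "\<forall>t\<in>{0..1}. f t > f_min"
    and noise: "prob_space P" "\<sigma> > 0" "iid_gaussian P \<sigma> \<xi>"
    and design: "\<forall>i\<ge>1. x i \<in> {0..1}"
    and design_dense: "\<exists>K>0. \<forall>b\<in>{0..1}. \<forall>c\<in>{0..1}. b < c \<longrightarrow>
      (\<exists>N. \<forall>n>N. empirical_cdf x n c - empirical_cdf x n b \<ge> K * (c - b))"
    and prior: "prior_measure \<mu>0"
    and gamma: "\<gamma> > 1"
    and prior_bounded: "AE a in \<mu>0. holder_norm \<gamma> a \<le> ennreal L"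
    and a_min: "a_min > 0"
    and prior_elliptic: "AE a in \<mu>0. \<forall>t\<in>{0..1}. a t \<ge> a_min"
    and truth: "a_dagger \<in> holder_supp \<gamma> \<mu>0"
    and gamma': "0 \<le> \<gamma>'" "\<gamma>' < \<gamma>"
  shows "posterior_consistent P \<xi> f \<sigma> \<mu>0 x \<gamma>' a_dagger"
proof -
  interpret P: prob_space P by (rule noise)
  interpret M: prob_space \<mu>0 using prior by (simp add: prior_measure_def)
  have f: "continuous_on {0..1} f" using f_smooth by (auto simp: smooth01_def Ck01_def dest: spec[of _ 0])
  obtain Fm where Fm: "\<And>t. t \<in> {0..1} \<Longrightarrow> \<bar>f t\<bar> \<le> Fm"
  proof -
    have "compact (f ` {0..1})" by (rule compact_continuous_image[OF f]) simp
    then obtain B where "\<forall>v\<in>f ` {0..1}. norm v \<le> B"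
      using compact_imp_bounded[of "f ` {0..1}"] unfolding bounded_iff by blast
    then show ?thesis by (intro that[of B]) auto
  qed
  have f_ge: "f t \<ge> f_min" if "t \<in> {0..1}" for t using f_min(2) that by (simp add: less_imp_le)
  have Fm_pos: "Fm > 0" using Fm[of 0] f_ge[of 0] f_min(1) by simp

  \<comment> \<open>One bound for the prior samples and for the truth, whose own norm is included.
    The 1 makes it positive.\<close>
  define L' where "L' = max 1 (max L (enn2real (holder_norm \<gamma> a_dagger)))"
  have L': "L' > 0" "L \<le> L'" "enn2real (holder_norm \<gamma> a_dagger) \<le> L'" by (auto simp: L'_def)
  have hb0: "holder_bounded \<gamma> L' a_dagger"
  proof (rule holder_norm_le_imp_bounded)
    have "holder_norm \<gamma> a_dagger < top" using truth by (simp add: holder_supp_def infinity_ennreal_def)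
    then have "holder_norm \<gamma> a_dagger = ennreal (enn2real (holder_norm \<gamma> a_dagger))" by simp
    also have "\<dots> \<le> ennreal L'" by (rule ennreal_leI) (rule L'(3))
    finally show "holder_norm \<gamma> a_dagger \<le> ennreal L'" .
  qed (use L' in simp)
  note cont0 = holder_bounded_gt_1(3)[OF hb0 gamma]
  have pos_ball: "emeasure \<mu>0 (holder_ball \<mu>0 \<gamma> a_dagger r) > 0" if "r > 0" for r
    using truth that by (simp add: holder_supp_def)
  have good: "AE a in \<mu>0. a \<in> space \<mu>0 \<and> holder_bounded \<gamma> L' a \<and> (\<forall>t\<in>{0..1}. a_min \<le> a t)"
    using prior_bounded prior_elliptic AE_space
  proof eventually_elim
    case (elim a)
    have "holder_norm \<gamma> a \<le> ennreal L'" using elim(1) ennreal_leI[OF L'(2)] by (rule order.trans)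
    then show ?case using holder_norm_le_imp_bounded[of \<gamma> a L'] L'(1) elim by simp
  qed
  \<comment> \<open>A support point inherits the lower bound: were it violated at \<open>t\<close>,
    a ball with radius half the deficit would contain a prior sample below \<open>a_min\<close> at
    \<open>t\<close>.\<close>
  have a0_ge: "\<forall>t\<in>{0..1}. a_min \<le> a_dagger t"
  proof (rule ballI, rule ccontr)
    fix t :: real assume t: "t \<in> {0..1}" and "\<not> a_min \<le> a_dagger t"
    then have r: "(a_min - a_dagger t) / 2 > 0" by simp
    obtain b where b: "b \<in> holder_ball \<mu>0 \<gamma> a_dagger ((a_min - a_dagger t) / 2)" "\<forall>t\<in>{0..1}. a_min \<le> b t"
      using AE_pos_emeasure_ex[OF prior_elliptic pos_ball[OF r]] by blast
    have "\<bar>b t - a_dagger t\<bar> \<le> (a_min - a_dagger t) / 2"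
      by (rule holder_norm_less_imp_abs_le[where \<gamma> = \<gamma> and u = "\<lambda>t. b t - a_dagger t", OF _ r t])
        (use b(1) in \<open>simp add: holder_ball_def\<close>)
    moreover have "a_min \<le> b t" using b(2) t by blast
    ultimately show False using r by (simp add: abs_le_iff)
  qed
  have pos: "\<forall>t\<in>{0..1}. 0 < a t" if "\<forall>t\<in>{0..1}. a_min \<le> a t" for a :: "real \<Rightarrow> real"
    using that a_min less_le_trans by blast

  define \<Delta> where "\<Delta> a t = forward f a t - forward f a_dagger t" for a t
  \<comment> \<open>Each of the two solutions contributes the slope bound
    \<open>Fm / a_min\<close>.\<close>
  define M where "M = 2 * (Fm / a_min)"
  have M: "M > 0" using Fm_pos a_min by (simp add: M_def)
  have \<Delta>_lip: "\<bar>\<Delta> a s - \<Delta> a t\<bar> \<le> M * \<bar>s - t\<bar>"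
    if a: "holder_bounded \<gamma> L' a" "\<forall>t\<in>{0..1}. a_min \<le> a t" and st: "s \<in> {0..1}" "t \<in> {0..1}" for a s t
  proof (rule Lipschitz01_deriv[OF _ _ st])
    note ac = holder_bounded_gt_1(3)[OF a(1) gamma]
    fix z :: real assume z: "z \<in> {0..1}"
    show "(\<Delta> a has_real_derivative (flux_const f a - source_int f z) / a z -
        (flux_const f a_dagger - source_int f z) / a_dagger z) (at z within {0..1})"
      unfolding \<Delta>_def by (intro DERIV_diff forward_deriv f ac cont0 pos a a0_ge z)
    show "\<bar>(flux_const f a - source_int f z) / a z - (flux_const f a_dagger - source_int f z) / a_dagger z\<bar> \<le> M"
      using forward_deriv_bound[OF f ac a_min a(2) Fm z] forward_deriv_bound[OF f cont0 a_min a0_ge Fm z]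
      unfolding M_def by linarith
  qed
  have \<Delta>_bd: "\<bar>\<Delta> a t\<bar> \<le> M"
    if a: "holder_bounded \<gamma> L' a" "\<forall>t\<in>{0..1}. a_min \<le> a t" and t: "t \<in> {0..1}" for a t
  proof -
    have "\<Delta> a 0 = 0"
      unfolding \<Delta>_def
      using forward_bdry(1)[OF f holder_bounded_gt_1(3)[OF a(1) gamma] pos[OF a(2)]]
        forward_bdry(1)[OF f cont0 pos[OF a0_ge]] by simp
    then have "\<bar>\<Delta> a t\<bar> \<le> M * \<bar>t\<bar>" using \<Delta>_lip[OF a t, of 0] by simp
    also have "\<dots> \<le> M * 1" using t M by (intro mult_left_mono) auto
    finally show ?thesis by simp
  qed

  obtain \<Phi> :: "real \<Rightarrow> (real \<Rightarrow> real) \<Rightarrow> real" where \<Phi>[measurable]: "\<And>t. \<Phi> t \<in> borel_measurable \<mu>0"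
    and \<Phi>_eq: "\<And>t a. \<lbrakk>t \<in> {0..1}; a \<in> space \<mu>0; \<forall>t\<in>{0..1}. a t > 0\<rbrakk> \<Longrightarrow> forward f a t = \<Phi> t a"
    using forward_measurable_version[OF prior f] by blast
  define y where "y \<omega> i = forward f a_dagger (x i) + \<xi> i \<omega>" for \<omega> i
  define W where "W n \<omega> a = exp (- (\<Sum>i=1..n. (\<Phi> (x i) a - y \<omega> i)\<^sup>2 / (2 * \<sigma>\<^sup>2)))" for n \<omega> a
  have W01: "0 < W n \<omega> a \<and> W n \<omega> a \<le> 1" for n \<omega> a
    unfolding W_def by (auto intro!: sum_nonneg)
  have \<xi>_meas: "\<xi> i \<in> borel_measurable P" if "i \<in> {1..n}" for i n
    using that by (intro iid_gaussian_measurable[OF noise(1,3)]) auto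
  \<comment> \<open>Joint measurability in noise and coefficient makes the posterior mass of the
    ball a random variable.\<close>
  have W_joint: "(\<lambda>(\<omega>, a). W n \<omega> a) \<in> borel_measurable (P \<Otimes>\<^sub>M \<mu>0)" for n
  proof -
    have [measurable]: "(\<lambda>p. \<xi> i (fst p)) \<in> borel_measurable (P \<Otimes>\<^sub>M \<mu>0)" if "i \<in> {1..n}" for i
      by (rule measurable_compose[OF measurable_fst \<xi>_meas[OF that]])
    show ?thesis unfolding W_def y_def case_prod_beta by measurable
  qed
  have W_meas[measurable]: "W n \<omega> \<in> borel_measurable \<mu>0" for n \<omega>
    unfolding W_def by measurable
  have lik: "AE a in \<mu>0. likelihood f \<sigma> x (y \<omega>) n a = W n \<omega> a" for n \<omega>
    using good
  proof eventually_elim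
    case (elim a)
    have "forward f a (x i) = \<Phi> (x i) a" if "i \<in> {1..n}" for i
      by (rule \<Phi>_eq) (use elim pos design that in auto)
    then show ?case by (simp add: likelihood_def W_def)
  qed
  have W_expand: "W n \<omega> a = exp (- (\<Sum>i=1..n. (\<xi> i \<omega>)\<^sup>2) / (2 * \<sigma>\<^sup>2)) *
     exp (- ((\<Sum>i=1..n. (\<Delta> a (x i))\<^sup>2) - 2 * (\<Sum>i=1..n. \<Delta> a (x i) * \<xi> i \<omega>)) / (2 * \<sigma>\<^sup>2))"
    if "a \<in> space \<mu>0" "\<forall>t\<in>{0..1}. a_min \<le> a t" for n \<omega> a
  proof -
    \<comment> \<open>The data contain the true solution, so the residual is the difference of the
      solutions minus the noise.\<close>
    have "\<Phi> (x i) a - y \<omega> i = \<Delta> a (x i) - \<xi> i \<omega>" if "i \<in> {1..n}" for i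
      using \<Phi>_eq[of "x i" a] \<open>a \<in> _\<close> pos[OF \<open>\<forall>t\<in>_. _ \<le> a t\<close>] design that by (simp add: \<Delta>_def y_def)
    then have "(\<Sum>i=1..n. (\<Phi> (x i) a - y \<omega> i)\<^sup>2 / (2 * \<sigma>\<^sup>2)) = (\<Sum>i=1..n. (\<Delta> a (x i) - \<xi> i \<omega>)\<^sup>2 / (2 * \<sigma>\<^sup>2))"
      by (intro sum.cong refl) (simp only:)
    then have "W n \<omega> a = exp (- (\<Sum>i=1..n. (\<Delta> a (x i) - \<xi> i \<omega>)\<^sup>2 / (2 * \<sigma>\<^sup>2)))"
      by (simp only: W_def)
    then show ?thesis using gaussian_likelihood_expand by metis
  qed

  have "\<exists>l. l \<longlonglongrightarrow> 1 \<and> (\<lambda>n. measure P {\<omega> \<in> space P.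
        measure (posterior f \<sigma> \<mu>0 x (y \<omega>) n) (holder_ball \<mu>0 \<gamma>' a_dagger \<epsilon>) \<ge> l n}) \<longlonglongrightarrow> 1"
    if \<epsilon>: "\<epsilon> > 0" for \<epsilon>
  proof -
    define B where "B = holder_ball \<mu>0 \<gamma>' a_dagger \<epsilon>"
    have B[measurable]: "B \<in> sets \<mu>0" unfolding B_def by (rule sets_holder_ball[OF prior cont0])
    obtain \<kappa> where \<kappa>: "\<kappa> > 0"
      "\<And>a. \<lbrakk>holder_bounded \<gamma> L' a; \<forall>t\<in>{0..1}. a_min \<le> a t; \<not> holder_norm \<gamma>' (\<lambda>t. a t - a_dagger t) < ennreal \<epsilon>\<rbrakk>
        \<Longrightarrow> \<exists>t\<in>{0..1}. \<bar>\<Delta> a t\<bar> > \<kappa>"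
      using Fm f_ge unfolding \<Delta>_def
      by (rule forward_identifies[OF f _ f_min(1) _ a_min L'(1) gamma gamma' \<epsilon> hb0 a0_ge]) blast+
    obtain c N where c: "c > 0"
      and sep: "\<And>n \<Delta>. \<lbrakk>n > N; \<forall>s\<in>{0..1}. \<forall>t\<in>{0..1}. \<bar>\<Delta> s - \<Delta> t\<bar> \<le> M * \<bar>s - t\<bar>; \<exists>t\<in>{0..1}. \<bar>\<Delta> t\<bar> > \<kappa>\<rbrakk> \<Longrightarrow>
        (\<Sum>i=1..n. (\<Delta> (x i))\<^sup>2) \<ge> c * real n"
      using design_separates[OF design_dense \<kappa>(1) less_imp_le[OF M]] by blast
    \<comment> \<open>The cross term is then at most \<open>2 * (c / 8) * n = c / 4 * n\<close>. It
      lowers the exponent \<open>c * n\<close> outside the ball to \<open>3 / 4 * c * n\<close> and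
      raises \<open>c / 4 * n\<close> near the truth to \<open>1 / 2 * c * n\<close>.\<close>
    define \<eta> where "\<eta> = c / (8 * M)"
    have \<eta>: "\<eta> > 0" "M * \<eta> = c / 8" using c M by (auto simp: \<eta>_def)
    \<comment> \<open>By \<open>forward_stable\<close>, coefficients within \<open>r\<close> of the
      truth have solutions within \<open>sqrt c / 2\<close>, hence squared differences at most
      \<open>c / 4\<close>.\<close>
    define r where "r = sqrt c / 2 * a_min\<^sup>2 / (2 * Fm)"
    have r: "r > 0" "2 * r * Fm / a_min\<^sup>2 = sqrt c / 2" using c a_min Fm_pos by (auto simp: r_def)
    \<comment> \<open>This ball is taken in the norm of the support hypothesis, which gives it
      positive prior mass.\<close>
    define U where "U = holder_ball \<mu>0 \<gamma> a_dagger r"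
    have U: "U \<in> sets \<mu>0" unfolding U_def by (rule sets_holder_ball[OF prior cont0])
    have qU: "measure \<mu>0 U > 0"
      using pos_ball[OF r(1)] unfolding U_def[symmetric] M.emeasure_eq_measure by simp
    \<comment> \<open>The rate is the gap \<open>3 / 4 * c - 1 / 2 * c\<close> between the two
      exponents, divided by \<open>2 * \<sigma>\<^sup>2\<close>.\<close>
    define l where "l n = 1 - exp (- (c / (8 * \<sigma>\<^sup>2)) * real n) / measure \<mu>0 U" for n
    have "(\<lambda>n. exp (- (c / (8 * \<sigma>\<^sup>2)) * real n)) \<longlonglongrightarrow> 0"
    proof -
      have "(\<lambda>n. exp (- (c / (8 * \<sigma>\<^sup>2))) ^ n) \<longlonglongrightarrow> 0"
        by (rule LIMSEQ_power_zero) (use c noise(2) in auto)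
      then show ?thesis by (simp add: exp_of_nat_mult[symmetric] mult.commute)
    qed
    then have "l \<longlonglongrightarrow> 1 - 0 / measure \<mu>0 U"
      unfolding l_def using qU by (intro tendsto_intros) auto
    then have l: "l \<longlonglongrightarrow> 1" by simp
    define A where "A n = {\<omega> \<in> space P. measure (posterior f \<sigma> \<mu>0 x (y \<omega>) n) B \<ge> l n}" for n
    have post: "measure (posterior f \<sigma> \<mu>0 x (y \<omega>) n) B = (\<integral>a. indicator B a * W n \<omega> a \<partial>\<mu>0) / (\<integral>a. W n \<omega> a \<partial>\<mu>0)"
      "integrable \<mu>0 (W n \<omega>)" "(\<integral>a. W n \<omega> a \<partial>\<mu>0) > 0" for n \<omega>
      by (rule measure_posterior[OF M.prob_space_axioms W_meas W01 lik B])+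
    have A_sets: "A n \<in> sets P" for n
    proof -
      note [measurable] = W_joint
      have "(\<lambda>\<omega>. (\<integral>a. indicator B a * W n \<omega> a \<partial>\<mu>0) / (\<integral>a. W n \<omega> a \<partial>\<mu>0)) \<in> borel_measurable P"
        by measurable
      then show ?thesis unfolding A_def post(1) by measurable
    qed
    \<comment> \<open>All randomness sits in \<open>nb\<close>; the rest is a pathwise comparison of
      likelihoods.\<close>
    have key: "\<omega> \<in> A n" if n: "n > N" and \<omega>: "\<omega> \<in> space P" and m: "m \<ge> 1"
      and nb: "noise_bound \<xi> x m n \<omega> < \<eta> * n" for n m \<omega>
    proof -
      define K where "K = exp (- (\<Sum>i=1..n. (\<xi> i \<omega>)\<^sup>2) / (2 * \<sigma>\<^sup>2))"
      have T: "\<bar>\<Sum>i=1..n. \<Delta> a (x i) * \<xi> i \<omega>\<bar> \<le> c / 8 * n"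
        if a: "holder_bounded \<gamma> L' a" "\<forall>t\<in>{0..1}. a_min \<le> a t" for a
      proof -
        have "\<bar>\<Sum>i=1..n. \<Delta> a (x i) * \<xi> i \<omega>\<bar> \<le> M * noise_bound \<xi> x m n \<omega>"
          by (rule noise_bound_uniform[OF m design]) (use M \<Delta>_bd[OF a] \<Delta>_lip[OF a] in auto)
        also have "\<dots> \<le> M * (\<eta> * n)" using nb M by (intro mult_left_mono) auto
        finally show ?thesis using \<eta>(2) by (simp add: mult.assoc[symmetric])
      qed
      have out: "AE a in \<mu>0. a \<notin> B \<longrightarrow> W n \<omega> a \<le> K * exp (- (3 / 4 * c * n) / (2 * \<sigma>\<^sup>2))"
        using good
      proof (rule eventually_mono, intro impI)
        fix a assume a: "a \<in> space \<mu>0 \<and> holder_bounded \<gamma> L' a \<and> (\<forall>t\<in>{0..1}. a_min \<le> a t)" and "a \<notin> B"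
        then have "\<exists>t\<in>{0..1}. \<bar>\<Delta> a t\<bar> > \<kappa>" by (intro \<kappa>(2)) (auto simp: B_def holder_ball_def)
        then have "(\<Sum>i=1..n. (\<Delta> a (x i))\<^sup>2) \<ge> c * real n"
          using a \<Delta>_lip by (intro sep[OF n]) auto
        moreover have "\<bar>\<Sum>i=1..n. \<Delta> a (x i) * \<xi> i \<omega>\<bar> \<le> c / 8 * n" using T a by blast
        ultimately have "(\<Sum>i=1..n. (\<Delta> a (x i))\<^sup>2) - 2 * (\<Sum>i=1..n. \<Delta> a (x i) * \<xi> i \<omega>) \<ge> 3 / 4 * c * n"
          by linarith
        then have "exp (- ((\<Sum>i=1..n. (\<Delta> a (x i))\<^sup>2) - 2 * (\<Sum>i=1..n. \<Delta> a (x i) * \<xi> i \<omega>)) / (2 * \<sigma>\<^sup>2))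
            \<le> exp (- (3 / 4 * c * n) / (2 * \<sigma>\<^sup>2))"
          unfolding exp_le_cancel_iff by (intro divide_right_mono le_imp_neg_le) auto
        then have "K * exp (- ((\<Sum>i=1..n. (\<Delta> a (x i))\<^sup>2) - 2 * (\<Sum>i=1..n. \<Delta> a (x i) * \<xi> i \<omega>)) / (2 * \<sigma>\<^sup>2))
            \<le> K * exp (- (3 / 4 * c * n) / (2 * \<sigma>\<^sup>2))"
          by (rule mult_left_mono) (simp add: K_def)
        then show "W n \<omega> a \<le> K * exp (- (3 / 4 * c * n) / (2 * \<sigma>\<^sup>2))"
          using a W_expand[of a] unfolding K_def by presburger
      qed
      have inside: "AE a in \<mu>0. a \<in> U \<longrightarrow> W n \<omega> a \<ge> K * exp (- (1 / 2 * c * n) / (2 * \<sigma>\<^sup>2))"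
        using good
      proof (rule eventually_mono, intro impI)
        fix a assume a: "a \<in> space \<mu>0 \<and> holder_bounded \<gamma> L' a \<and> (\<forall>t\<in>{0..1}. a_min \<le> a t)" and "a \<in> U"
        then have "holder_norm \<gamma> (\<lambda>t. a t - a_dagger t) < ennreal r" by (simp add: U_def holder_ball_def)
        then have close: "\<bar>a t - a_dagger t\<bar> \<le> r" if "t \<in> {0..1}" for t
          using holder_norm_less_imp_abs_le[OF _ r(1) that] by blast
        have ac: "continuous_on {0..1} a" using a holder_bounded_gt_1(3)[OF _ gamma] by blast
        have "(\<Delta> a (x i))\<^sup>2 \<le> c / 4" if "i \<in> {1..n}" for i
        proof -
          have "x i \<in> {0..1}" using design that by simp
          then have "\<bar>\<Delta> a (x i)\<bar> \<le> sqrt c / 2"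
            unfolding \<Delta>_def r(2)[symmetric] using a
            by (intro forward_stable[OF f ac cont0 a_min _ a0_ge Fm close]) auto
          then have "\<bar>\<Delta> a (x i)\<bar>\<^sup>2 \<le> (sqrt c / 2)\<^sup>2" by (intro power_mono) auto
          then show ?thesis using c by (simp add: power_divide)
        qed
        then have "(\<Sum>i=1..n. (\<Delta> a (x i))\<^sup>2) \<le> (\<Sum>i=1..n. c / 4)" by (rule sum_mono)
        also have "\<dots> = c / 4 * n" by simp
        finally have "(\<Sum>i=1..n. (\<Delta> a (x i))\<^sup>2) \<le> c / 4 * n" .
        moreover have "\<bar>\<Sum>i=1..n. \<Delta> a (x i) * \<xi> i \<omega>\<bar> \<le> c / 8 * n" using T a by blast
        ultimately have "(\<Sum>i=1..n. (\<Delta> a (x i))\<^sup>2) - 2 * (\<Sum>i=1..n. \<Delta> a (x i) * \<xi> i \<omega>) \<le> 1 / 2 * c * n"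
          by linarith
        then have "exp (- (1 / 2 * c * n) / (2 * \<sigma>\<^sup>2)) \<le>
            exp (- ((\<Sum>i=1..n. (\<Delta> a (x i))\<^sup>2) - 2 * (\<Sum>i=1..n. \<Delta> a (x i) * \<xi> i \<omega>)) / (2 * \<sigma>\<^sup>2))"
          unfolding exp_le_cancel_iff by (intro divide_right_mono le_imp_neg_le) auto
        then have "K * exp (- (1 / 2 * c * n) / (2 * \<sigma>\<^sup>2)) \<le>
            K * exp (- ((\<Sum>i=1..n. (\<Delta> a (x i))\<^sup>2) - 2 * (\<Sum>i=1..n. \<Delta> a (x i) * \<xi> i \<omega>)) / (2 * \<sigma>\<^sup>2))"
          by (rule mult_left_mono) (simp add: K_def)
        then show "W n \<omega> a \<ge> K * exp (- (1 / 2 * c * n) / (2 * \<sigma>\<^sup>2))"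
          using a W_expand[of a] unfolding K_def by presburger
      qed
      have "1 - K * exp (- (3 / 4 * c * n) / (2 * \<sigma>\<^sup>2)) / (K * exp (- (1 / 2 * c * n) / (2 * \<sigma>\<^sup>2)) * measure \<mu>0 U)
          \<le> measure (posterior f \<sigma> \<mu>0 x (y \<omega>) n) B"
        unfolding post(1)
        by (rule weighted_ratio_bound[OF M.prob_space_axioms post(2,3) B U qU _ out inside])
          (use W01 in \<open>auto simp: K_def less_imp_le\<close>)
      also have "1 - K * exp (- (3 / 4 * c * n) / (2 * \<sigma>\<^sup>2)) / (K * exp (- (1 / 2 * c * n) / (2 * \<sigma>\<^sup>2)) * measure \<mu>0 U) = l n"
      proof -
        have "- (3 / 4 * c * n) / (2 * \<sigma>\<^sup>2) = - (c / (8 * \<sigma>\<^sup>2)) * n + - (1 / 2 * c * n) / (2 * \<sigma>\<^sup>2)"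
          using noise(2) by (simp add: field_simps)
        then have "exp (- (3 / 4 * c * n) / (2 * \<sigma>\<^sup>2)) = exp (- (c / (8 * \<sigma>\<^sup>2)) * n) * exp (- (1 / 2 * c * n) / (2 * \<sigma>\<^sup>2))"
          by (simp only: exp_add)
        moreover have "K > 0" by (simp add: K_def)
        ultimately show ?thesis by (simp add: l_def)
      qed
      finally show ?thesis using \<omega> by (simp add: A_def)
    qed
    have "(\<lambda>n. measure P (A n)) \<longlonglongrightarrow> 1"
    proof (rule LIMSEQ_I)
      fix e :: real assume "e > 0"
      then have e: "e / 2 > 0" by simp
      \<comment> \<open>The mesh depends on \<open>e\<close>, whereas \<open>l\<close> and the
        events \<open>A n\<close> do not, so it can be chosen anew for every
        \<open>e\<close>.\<close>
      obtain m N' where m: "m \<ge> 1"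
        and N': "\<And>n. n \<ge> N' \<Longrightarrow> measure P {\<omega> \<in> space P. noise_bound \<xi> x m n \<omega> \<ge> \<eta> * n} \<le> e / 2"
        using noise_bound_small[OF noise \<eta>(1) e] by metis
      have "norm (measure P (A n) - 1) < e" if n: "n \<ge> max N' (Suc N)" for n
      proof -
        have nb[measurable]: "noise_bound \<xi> x m n \<in> borel_measurable P"
          using noise_bound_integral(1)[OF noise m] by (rule borel_measurable_integrable)
        let ?C = "{\<omega> \<in> space P. noise_bound \<xi> x m n \<omega> \<ge> \<eta> * n}"
        have C: "?C \<in> sets P" by measurable
        have "1 - measure P ?C = measure P (space P - ?C)" using P.prob_compl[OF C] by simp
        also have "\<dots> \<le> measure P (A n)"
        proof (rule P.finite_measure_mono[OF _ A_sets], rule subsetI)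
          fix \<omega> assume "\<omega> \<in> space P - ?C"
          then show "\<omega> \<in> A n" using n by (intro key[OF _ _ m]) auto
        qed
        finally show ?thesis using N'[of n] n P.prob_le_1[of "A n"] \<open>e > 0\<close> by simp
      qed
      then show "\<exists>no. \<forall>n\<ge>no. norm (measure P (A n) - 1) < e" by blast
    qed
    then show ?thesis using l unfolding A_def B_def by blast
  qed
  then show ?thesis unfolding posterior_consistent_def y_def by blast
qed

end
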